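(* Let $\mathcal{F}$ denote the family of continuous cumulative distribution functions $F$ satisfying $F(0)=0$, whose corresponding probability density function $f$ satisfies $f(0)>0$ and admits a Maclaurin series expansion for every $x>0$. Let $X_1,X_2,\dots,X_n$ be a random sample (i.i.d.) from a distribution $F\in\mathcal{F}$. Let $j$ and $k$ be fixed integers such that $1\le j<k<(n+j)/2<n$, and let $X_{01},X_{02},\dots,X_{0j}$ be independent random variables, independent of the sample $X_1,\dots,X_n$, each with distribution $F$. If \[ X_{(k-j;n)}+\sum_{i=1}^{j}\frac{1}{n-k+i}X_{0i}\overset{d}{=}X_{(k;n)}, \] then $F$ is the distribution function of the exponential distribution $\mathcal{E}(\lambda)$ for some $\lambda>0$.
   Context: $X_{(m;n)}$ denotes the $m$-th order statistic (the $m$-th smallest value) of the sample $X_1,\dots,X_n$. The symbol $\overset{d}{=}$ means equality in distribution. $\mathcal{E}(\lambda)$ is the exponential distribution with density $f(x)=\lambda e^{-\lambda x}$ for $x\ge 0$ (and $0$ for $x<0$). "Admits a Maclaurin series expansion for every $x>0$" means that $f(x)=\sum_{q\ge 0}\frac{f^{(q)}(0)}{q!}x^q$ for every $x>0$, where $f(0)$ and the derivatives $f^{(q)}(0)$ are understood as one-sided (from the right) at $0$. *)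

theory Defs
  imports "HOL-Probability.Probability"
begin

text \<open>Meaningful for \<open>1 \<le> m \<le> n\<close>; the sample is indexed \<open>X 1, \<dots>, X n\<close>, lists from \<open>0\<close>.\<close>

definition order_stat :: "(nat \<Rightarrow> 'a \<Rightarrow> real) \<Rightarrow> nat \<Rightarrow> nat \<Rightarrow> 'a \<Rightarrow> real" where
  "order_stat X m n \<omega> = sort (map (\<lambda>i. X i \<omega>) [1..<Suc n]) ! (m - 1)"

definition eq_in_dist :: "'a measure \<Rightarrow> ('a \<Rightarrow> real) \<Rightarrow> ('a \<Rightarrow> real) \<Rightarrow> bool" where
  "eq_in_dist M U V \<longleftrightarrow> distr M borel U = distr M borel V"

definition is_cdf :: "(real \<Rightarrow> real) \<Rightarrow> bool" where
  "is_cdf F \<longleftrightarrow> (\<exists>N. real_distribution N \<and> F = cdf N)"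

definition is_pdf_of :: "(real \<Rightarrow> real) \<Rightarrow> (real \<Rightarrow> real) \<Rightarrow> bool" where
  "is_pdf_of f F \<longleftrightarrow> f \<in> borel_measurable lborel \<and> (\<forall>x. 0 \<le> f x) \<and>
     prob_space (density lborel (\<lambda>x. ennreal (f x))) \<and>
     F = cdf (density lborel (\<lambda>x. ennreal (f x)))"

text \<open>The \<open>q\<close>-th derivative on the half-line \<open>[0, \<infinity>)\<close>: the ordinary derivative at points \<open>x > 0\<close>,
  the right derivative at \<open>0\<close>.\<close>

definition half_line_deriv :: "nat \<Rightarrow> (real \<Rightarrow> real) \<Rightarrow> real \<Rightarrow> real" where
  "half_line_deriv q f = ((\<lambda>g x. vector_derivative g (at x within {0..})) ^^ q) f"

text \<open>The differentiability clause, which says that the derivatives in the series exist, costs no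
  generality. The term \<open>q = 0\<close> is \<open>f 0\<close>, so the series converges to \<open>f\<close> on all of \<open>[0, \<infinity>)\<close>, and
  this alone makes \<open>f\<close> infinitely differentiable there.\<close>

definition has_maclaurin_expansion :: "(real \<Rightarrow> real) \<Rightarrow> bool" where
  "has_maclaurin_expansion f \<longleftrightarrow>
     (\<forall>q. half_line_deriv q f differentiable_on {0..}) \<and>
     (\<forall>x>0. (\<lambda>q. half_line_deriv q f 0 / fact q * x ^ q) sums f x)"

text \<open>A density is determined only almost everywhere, so the regularity conditions are
  required of some version of it.\<close>

definition maclaurin_family :: "(real \<Rightarrow> real) set" where
  "maclaurin_family = {F. is_cdf F \<and> continuous_on UNIV F \<and> F 0 = 0 \<and>
     (\<exists>f. is_pdf_of f F \<and> f 0 > 0 \<and> has_maclaurin_expansion f)}"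

definition exponential_cdf :: "real \<Rightarrow> real \<Rightarrow> real" where
  "exponential_cdf l = cdf (density lborel (\<lambda>x. ennreal (exponential_density l x)))"

end

theory Submission
  imports Defs
begin

text \<open>
  Laplace transforms turn the equation in distribution into the identity

    \<open>\<phi>\<^sub>k s = \<phi>\<^bsub>k-j\<^esub> s * (\<Prod>i=1..j. \<phi> (s / (n - k + i)))\<close> for all \<open>s > 0\<close>,

  where \<open>\<phi>\<^sub>m\<close> is the transform of the \<open>m\<close>-th order statistic and \<open>\<phi>\<close> that of \<open>F\<close>
  (\<open>laplace_stieltjes_order_stat_identity\<close>). The exponential distribution of any rate \<open>l\<close>
  satisfies it, by the independence of exponential spacings
  (\<open>laplace_stieltjes_exp_order_stat\<close>). The proof shows that a distribution from the family
  has no room to differ from the exponential one of rate \<open>l = f 0\<close>.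

  Since \<open>F\<close> is given on \<open>[0, \<infinity>)\<close> by a power series (\<open>maclaurin_coefficients_of_cdf\<close>), any
  difference from \<open>1 - exp (- l * x)\<close> has a leading term \<open>c * x ^ (r + 1)\<close>, and \<open>r \<ge> 1\<close> because the
  linear terms agree. The behaviour of a distribution function at \<open>0\<close> determines that of its
  transform at infinity (\<open>laplace_stieltjes_abelian\<close>), and the distribution function of an order
  statistic is a polynomial in \<open>F\<close> (\<open>cdf_order_stat\<close>). So every factor of the identity equals its
  exponential counterpart up to a relative error of order \<open>1 / s ^ r\<close> with a computable constant
  (\<open>laplace_stieltjes_ratio_tendsto\<close>). These errors add up in products, and comparing both sides gives

    \<open>c * (fact (k + r) / fact (k - 1))
       = c * (fact (k - j + r) / fact (k - j - 1) + fact (r + 1) * (\<Sum>i=1..j. (n - k + i) ^ r))\<close>.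

  The difference of the two factorial quotients is at most \<open>fact (r + 1)\<close> times the sum of the powers
  \<open>(k - j + i) ^ r\<close>, since a rising factorial is at most \<open>fact r\<close> times a power
  (\<open>fact_quotient_le\<close>). The hypothesis \<open>k < (n + j) / 2\<close> means \<open>k - j < n - k\<close>, so the right-hand
  coefficient is strictly larger (\<open>fact_quotient_less\<close>) and \<open>c = 0\<close> (\<open>perturbation_vanishes\<close>).
  Hence all coefficients of the difference vanish.
\<close>

section \<open>Laplace--Stieltjes transforms\<close>

text \<open>If \<open>H\<close> is the distribution function of a random variable \<open>X \<ge> 0\<close> without atom at \<open>0\<close>, this is
  \<open>E (exp (- s * X))\<close> after integration by parts. Working with \<open>H\<close> rather than with its Stieltjes
  measure keeps all integrands bounded and makes densities of order statistics unnecessary.\<close>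

definition laplace_stieltjes :: "(real \<Rightarrow> real) \<Rightarrow> real \<Rightarrow> real" where
  "laplace_stieltjes H s = (\<integral>u. indicator {0..} u * (s * exp (- s * u) * H u) \<partial>lborel)"

lemma has_bochner_integral_power_times_exp:
  "has_bochner_integral lborel (\<lambda>y::real. indicator {0..} y * (y ^ p * exp (- y))) (fact p)"
proof (rule has_bochner_integral_nn_integral)
  show "(\<integral>\<^sup>+y. ennreal (indicator {0..} y * (y ^ p * exp (- y))) \<partial>lborel) = ennreal (fact p)"
    using nn_intergal_power_times_exp_Ici[of p]
    by (subst (asm) of_nat_fact)
       (auto simp: indicator_def of_nat_fact intro!: nn_integral_cong cong: nn_integral_cong elim!: trans[rotated])
qed (auto simp: indicator_def)

lemma has_bochner_integral_exp_scaled: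
  fixes s :: real
  assumes "s > 0"
  shows "has_bochner_integral lborel (\<lambda>u. indicator {0..} u * (s * exp (- s * u))) 1"
proof -
  have "has_bochner_integral lborel
      (\<lambda>u. indicator {0..} (0 + s * u) * ((0 + s * u) ^ 0 * exp (- (0 + s * u)))) (fact 0 /\<^sub>R \<bar>s\<bar>)"
    by (rule lborel_has_bochner_integral_real_affine_iff[THEN iffD1, OF _ has_bochner_integral_power_times_exp])
       (use assms in auto)
  then have "has_bochner_integral lborel
      (\<lambda>u. s * (indicator {0..} (0 + s * u) * ((0 + s * u) ^ 0 * exp (- (0 + s * u))))) (s * (fact 0 /\<^sub>R \<bar>s\<bar>))"
    by (rule has_bochner_integral_mult_right) 
  also have "s * (fact 0 /\<^sub>R \<bar>s\<bar>) = 1"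
    using assms by simp
  also have "(\<lambda>u. s * (indicator {0..} (0 + s * u) * ((0 + s * u) ^ 0 * exp (- (0 + s * u)))))
      = (\<lambda>u. indicator {0..} u * (s * exp (- s * u)))"
    using assms by (auto simp: indicator_def fun_eq_iff zero_le_mult_iff)
  finally show ?thesis .
qed

text \<open>Quotients \<open>H u / u ^ p\<close> and one-sided hypotheses leave the value at the end point \<open>0\<close> of the
  half-line uncontrolled; this lemma discards it.\<close>

lemma lborel_integral_cong_except_0:
  fixes f g :: "real \<Rightarrow> real"
  assumes "f \<in> borel_measurable borel" "g \<in> borel_measurable borel" "\<And>x. x \<noteq> 0 \<Longrightarrow> f x = g x"
  shows "(\<integral>x. f x \<partial>lborel) = (\<integral>x. g x \<partial>lborel)"
proof (rule integral_cong_AE)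
  show "AE x in lborel. f x = g x"
    using AE_lborel_singleton[of "0 :: real"] by (rule AE_mp) (use assms(3) in auto)
qed (use assms in auto)

lemma laplace_stieltjes_integrable:
  fixes H :: "real \<Rightarrow> real"
  assumes [measurable]: "H \<in> borel_measurable borel" and B: "\<And>u. u \<ge> 0 \<Longrightarrow> \<bar>H u\<bar> \<le> B" and s: "s > 0"
  shows "integrable lborel (\<lambda>u. indicator {0..} u * (s * exp (- s * u) * H u))"
proof (rule Bochner_Integration.integrable_bound)
  show "integrable lborel (\<lambda>u. B * (indicator {0..} u * (s * exp (- s * u))))"
    using has_bochner_integral_exp_scaled[OF s] by (auto simp: has_bochner_integral_iff)
  show "AE u in lborel. norm (indicator {0..} u * (s * exp (- s * u) * H u))
      \<le> norm (B * (indicator {0..} u * (s * exp (- s * u))))"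
  proof (intro AE_I2)
    fix u :: real
    show "norm (indicator {0..} u * (s * exp (- s * u) * H u))
        \<le> norm (B * (indicator {0..} u * (s * exp (- s * u))))"
    proof (cases "u \<ge> 0")
      case True
      then have "\<bar>H u\<bar> \<le> \<bar>B\<bar>" using B[of u] by linarith
      then show ?thesis using True s by (auto simp: abs_mult)
    qed auto
  qed
qed measurable

lemma laplace_stieltjes_diff:
  fixes H K :: "real \<Rightarrow> real"
  assumes "H \<in> borel_measurable borel" "\<And>u. u \<ge> 0 \<Longrightarrow> \<bar>H u\<bar> \<le> B"
    and "K \<in> borel_measurable borel" "\<And>u. u \<ge> 0 \<Longrightarrow> \<bar>K u\<bar> \<le> C" and "s > 0"
  shows "laplace_stieltjes (\<lambda>u. H u - K u) s = laplace_stieltjes H s - laplace_stieltjes K s"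
  unfolding laplace_stieltjes_def
  by (subst Bochner_Integration.integral_diff[symmetric])
     (use laplace_stieltjes_integrable[of H B s] laplace_stieltjes_integrable[of K C s] assms in \<open>auto simp: algebra_simps\<close>)

text \<open>The substitution \<open>y = s * u\<close>, which moves the parameter from the kernel into \<open>H\<close>.\<close>

lemma laplace_stieltjes_rescale:
  fixes H :: "real \<Rightarrow> real"
  assumes "s > 0"
  shows "laplace_stieltjes H s = (\<integral>y. indicator {0..} y * (exp (- y) * H (y / s)) \<partial>lborel)"
proof -
  have "laplace_stieltjes H s = \<bar>1 / s\<bar> *\<^sub>R (\<integral>y. indicator {0..} (0 + 1 / s * y) * (s * exp (- s * (0 + 1 / s * y)) * H (0 + 1 / s * y)) \<partial>lborel)"
    unfolding laplace_stieltjes_def by (rule lborel_integral_real_affine) (use assms in simp)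
  also have "\<dots> = (\<integral>y. \<bar>1 / s\<bar> *\<^sub>R (indicator {0..} (0 + 1 / s * y) * (s * exp (- s * (0 + 1 / s * y)) * H (0 + 1 / s * y))) \<partial>lborel)"
    by simp
  also have "\<dots> = (\<integral>y. indicator {0..} y * (exp (- y) * H (y / s)) \<partial>lborel)"
    by (rule Bochner_Integration.integral_cong)
       (use assms in \<open>auto simp: indicator_def zero_le_divide_iff\<close>)
  finally show ?thesis .
qed

text \<open>An Abelian theorem: the behaviour of \<open>H\<close> at \<open>0\<close> governs that of its transform at infinity. After
  rescaling, the integrand times \<open>s ^ p\<close> is \<open>y ^ p * exp (- y)\<close> times \<open>H u / u ^ p\<close> at \<open>u = y / s\<close>.
  That quotient tends to \<open>c\<close> and is bounded on the whole half-line (near \<open>0\<close> because it converges,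
  elsewhere because \<open>H\<close> is bounded), so dominated convergence and the Gamma integral give the limit.\<close>

lemma laplace_stieltjes_abelian:
  fixes H :: "real \<Rightarrow> real"
  assumes H [measurable]: "H \<in> borel_measurable borel" and B: "\<And>u. u \<ge> 0 \<Longrightarrow> \<bar>H u\<bar> \<le> B"
    and lim: "((\<lambda>u. H u / u ^ p) \<longlongrightarrow> c) (at_right 0)"
  shows "((\<lambda>s. s ^ p * laplace_stieltjes H s) \<longlongrightarrow> c * fact p) at_top"
proof -
  have "\<forall>\<^sub>F u in at_right 0. dist (H u / u ^ p) c < 1"
    using lim by (rule tendstoD) simp
  then obtain d where d: "d > 0" "\<And>u. 0 < u \<Longrightarrow> u < d \<Longrightarrow> \<bar>H u / u ^ p - c\<bar> < 1"
    by (auto simp: eventually_at_right_field dist_real_def)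
  \<comment> \<open>One bound for \<open>H u / u ^ p\<close>: the first entry works below \<open>d\<close>, the second above.\<close>
  define C where "C = max (\<bar>c\<bar> + 1) (B / d ^ p)"
  have C: "\<bar>H u / u ^ p\<bar> \<le> C" if "u > 0" for u
  proof (cases "u < d")
    case True
    then show ?thesis using d(2)[of u] that by (auto simp: C_def)
  next
    case False
    have "\<bar>H u / u ^ p\<bar> = \<bar>H u\<bar> / u ^ p" using that by simp
    also have "\<dots> \<le> B / d ^ p"
      using B[of u] that False d(1) by (intro frac_le power_mono) auto
    finally show ?thesis by (auto simp: C_def)
  qed
  have "((\<lambda>s. \<integral>y. indicator {0<..} y * (y ^ p * exp (- y) * (H (y / s) / (y / s) ^ p)) \<partial>lborel)
      \<longlongrightarrow> (\<integral>y. indicator {0<..} y * (y ^ p * exp (- y)) * c \<partial>lborel)) at_top"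
  proof (rule integral_dominated_convergence_at_top[where w = "\<lambda>y. indicator {0..} y * (y ^ p * exp (- y)) * C"])
    show "integrable lborel (\<lambda>y. indicator {0..} y * (y ^ p * exp (- y)) * C)"
      using has_bochner_integral_power_times_exp[of p] by (auto simp: has_bochner_integral_iff)
    show "\<forall>\<^sub>F s in at_top. AE y in lborel. norm (indicator {0<..} y * (y ^ p * exp (- y) * (H (y / s) / (y / s) ^ p)))
        \<le> indicator {0..} y * (y ^ p * exp (- y)) * C"
      using eventually_gt_at_top[of 0]
    proof eventually_elim
      case (elim s)
      show ?case
      proof (intro AE_I2)
        fix y :: real
        show "norm (indicator {0<..} y * (y ^ p * exp (- y) * (H (y / s) / (y / s) ^ p)))
            \<le> indicator {0..} y * (y ^ p * exp (- y)) * C"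
        proof (cases "y > 0")
          case True
          have "norm (indicator {0<..} y * (y ^ p * exp (- y) * (H (y / s) / (y / s) ^ p)))
              = y ^ p * exp (- y) * \<bar>H (y / s) / (y / s) ^ p\<bar>"
            using True elim by (simp add: abs_mult)
          also have "\<dots> \<le> y ^ p * exp (- y) * C"
            using True elim by (intro mult_left_mono C) auto
          finally show ?thesis using True by simp
        next
          case False
          have "C \<ge> 0" by (auto simp: C_def)
          with False show ?thesis by (auto simp: indicator_def)
        qed
      qed
    qed
    show "AE y in lborel. ((\<lambda>s. indicator {0<..} y * (y ^ p * exp (- y) * (H (y / s) / (y / s) ^ p)))
        \<longlongrightarrow> indicator {0<..} y * (y ^ p * exp (- y)) * c) at_top"
    proof (intro AE_I2)
      fix y :: real
      show "((\<lambda>s. indicator {0<..} y * (y ^ p * exp (- y) * (H (y / s) / (y / s) ^ p)))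
        \<longlongrightarrow> indicator {0<..} y * (y ^ p * exp (- y)) * c) at_top"
      proof (cases "y > 0")
        case True
        have "filterlim (\<lambda>s. y / s) (at_right 0) at_top"
          using True by (auto simp: filterlim_at intro!: tendsto_divide_0[OF tendsto_const] filterlim_at_top_imp_at_infinity filterlim_ident
              intro: eventually_mono[OF eventually_gt_at_top[of 0]])
        from filterlim_compose[OF lim this] have "((\<lambda>s. H (y / s) / (y / s) ^ p) \<longlongrightarrow> c) at_top" .
        from tendsto_mult_left[OF this, of "y ^ p * exp (- y)"] show ?thesis
          using True by (simp add: mult.assoc)
      qed auto
    qed
  qed measurable
  also have "(\<integral>y. indicator {0<..} y * (y ^ p * exp (- y)) * c \<partial>lborel)
      = (\<integral>y. indicator {0..} y * (y ^ p * exp (- y)) * c \<partial>lborel)"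
    by (rule lborel_integral_cong_except_0) (auto simp: indicator_def)
  also have "\<dots> = c * fact p"
    using has_bochner_integral_power_times_exp[of p] by (simp add: has_bochner_integral_iff)
  finally have *: "((\<lambda>s. \<integral>y. indicator {0<..} y * (y ^ p * exp (- y) * (H (y / s) / (y / s) ^ p)) \<partial>lborel)
      \<longlongrightarrow> c * fact p) at_top" .
  show ?thesis
  proof (rule Lim_transform_eventually[OF *])
    show "\<forall>\<^sub>F s in at_top. (\<integral>y. indicator {0<..} y * (y ^ p * exp (- y) * (H (y / s) / (y / s) ^ p)) \<partial>lborel) = s ^ p * laplace_stieltjes H s"
      using eventually_gt_at_top[of 0]
    proof eventually_elim
      case (elim s)
      have "s ^ p * laplace_stieltjes H s = (\<integral>y. s ^ p * (indicator {0..} y * (exp (- y) * H (y / s))) \<partial>lborel)"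
        using elim by (simp add: laplace_stieltjes_rescale)
      also have "\<dots> = (\<integral>y. indicator {0<..} y * (y ^ p * exp (- y) * (H (y / s) / (y / s) ^ p)) \<partial>lborel)"
        using elim by (intro lborel_integral_cong_except_0) (auto simp: indicator_def power_divide)
      finally show ?case by simp
    qed
  qed
qed

text \<open>Integration by parts: the derivative of \<open>s * exp (- s * u) * H u\<close> integrates to \<open>0\<close> over the
  half-line, since \<open>H 0 = 0\<close> and \<open>H\<close> is bounded.\<close>

lemma laplace_stieltjes_deriv:
  fixes H h :: "real \<Rightarrow> real"
  assumes D: "\<And>u. (H has_real_derivative h u) (at u)" and h: "continuous_on UNIV h"
    and B: "\<And>u. u \<ge> 0 \<Longrightarrow> \<bar>H u\<bar> \<le> B" and C: "\<And>u. u \<ge> 0 \<Longrightarrow> \<bar>h u\<bar> \<le> C"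
    and H0: "H 0 = 0" and s: "s > 0"
  shows "laplace_stieltjes h s = s * laplace_stieltjes H s"
proof -
  have cH: "continuous_on UNIV H"
    by (meson D DERIV_isCont continuous_at_imp_continuous_on)
  have [measurable]: "H \<in> borel_measurable borel" "h \<in> borel_measurable borel"
    using cH h by (auto intro: borel_measurable_continuous_onI)
  have iH: "integrable lborel (\<lambda>u. indicator {0..} u * (s * exp (- s * u) * H u))"
    by (rule laplace_stieltjes_integrable[OF _ B s]) auto
  have ih: "integrable lborel (\<lambda>u. indicator {0..} u * (s * exp (- s * u) * h u))"
    by (rule laplace_stieltjes_integrable[OF _ C s]) auto
  let ?g = "\<lambda>u. s * exp (- s * u) * h u - s * (s * exp (- s * u) * H u)"
  have i: "integrable lborel (\<lambda>u. indicator {0..} u * ?g u)"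
    using Bochner_Integration.integrable_diff[OF ih integrable_mult_right[OF iH, of s]]
    by (simp add: algebra_simps)
  have "(LBINT u=0..\<infinity>. ?g u) = 0 - 0"
  proof (rule interval_integral_FTC_integrable[where F = "\<lambda>u. s * exp (- s * u) * H u"])
    show "((\<lambda>u. s * exp (- s * u) * H u) has_vector_derivative ?g u) (at u)" for u
      unfolding has_real_derivative_iff_has_vector_derivative[symmetric]
      by (auto intro!: derivative_eq_intros D simp: algebra_simps)
    show "isCont ?g u" for u
      using h cH by (auto intro!: continuous_intros simp: continuous_on_eq_continuous_at)
    have "set_integrable lborel {0..} ?g"
      using i by (simp add: set_integrable_def)
    then show "set_integrable lborel (einterval 0 \<infinity>) ?g"
      by (rule set_integrable_subset) (auto simp: einterval_def zero_ereal_def)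
    have "isCont (\<lambda>u. s * exp (- s * u) * H u) 0"
      using cH by (auto intro!: continuous_intros simp: continuous_on_eq_continuous_at)
    then have "((\<lambda>u. s * exp (- s * u) * H u) \<longlongrightarrow> 0) (at_right 0)"
      using H0 by (auto simp: isCont_def intro: tendsto_within_subset)
    then show "(((\<lambda>u. s * exp (- s * u) * H u) \<circ> real_of_ereal) \<longlongrightarrow> 0) (at_right 0)"
      by (simp add: zero_ereal_def ereal_tendsto_simps)
    have "((\<lambda>u. s * exp (- s * u) * H u) \<longlongrightarrow> 0) at_top"
    proof (rule Lim_null_comparison)
      show "\<forall>\<^sub>F u in at_top. norm (s * exp (- s * u) * H u) \<le> s * exp (- s * u) * B"
        using eventually_ge_at_top[of 0] by eventually_elim (use B s in \<open>auto simp: abs_mult\<close>)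
      show "((\<lambda>u. s * exp (- s * u) * B) \<longlongrightarrow> 0) at_top"
        using s by (intro tendsto_mult_left_zero tendsto_mult_right_zero filterlim_compose[OF exp_at_bot]
            filterlim_tendsto_neg_mult_at_bot[OF tendsto_const] filterlim_ident) auto
    qed
    then show "(((\<lambda>u. s * exp (- s * u) * H u) \<circ> real_of_ereal) \<longlongrightarrow> 0) (at_left \<infinity>)"
      by (simp add: ereal_tendsto_simps)
  qed auto
  also have "(LBINT u=0..\<infinity>. ?g u) = (\<integral>u. indicator {0..} u * ?g u \<partial>lborel)"
    unfolding interval_lebesgue_integral_def set_lebesgue_integral_def
    by (auto intro!: lborel_integral_cong_except_0 simp: einterval_def indicator_def zero_ereal_def)
  also have "\<dots> = (\<integral>u. indicator {0..} u * (s * exp (- s * u) * h u) - s * (indicator {0..} u * (s * exp (- s * u) * H u)) \<partial>lborel)"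
    by (simp add: algebra_simps)
  also have "\<dots> = laplace_stieltjes h s - s * laplace_stieltjes H s"
    unfolding laplace_stieltjes_def using ih iH by (subst Bochner_Integration.integral_diff) auto
  finally show ?thesis by simp
qed

section \<open>Binomial tail polynomials\<close>

definition binomial_tail :: "nat \<Rightarrow> nat \<Rightarrow> real \<Rightarrow> real" where
  "binomial_tail n m p = (\<Sum>i=m..n. real (n choose i) * p ^ i * (1 - p) ^ (n - i))"

lemma binomial_tail_nonneg: "0 \<le> p \<Longrightarrow> p \<le> 1 \<Longrightarrow> 0 \<le> binomial_tail n m p"
  unfolding binomial_tail_def by (intro sum_nonneg mult_nonneg_nonneg) auto

lemma binomial_tail_le_1:
  assumes "0 \<le> p" "p \<le> 1"
  shows "binomial_tail n m p \<le> 1"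
proof -
  have "binomial_tail n m p \<le> (\<Sum>i\<le>n. real (n choose i) * p ^ i * (1 - p) ^ (n - i))"
    unfolding binomial_tail_def using assms by (intro sum_mono2 mult_nonneg_nonneg) auto
  also have "\<dots> = (p + (1 - p)) ^ n"
    by (rule binomial_ring[symmetric])
  finally show ?thesis by simp
qed

lemma binomial_tail_0: "m \<ge> 1 \<Longrightarrow> binomial_tail n m 0 = 0"
  unfolding binomial_tail_def by (intro sum.neutral) auto

lemma binomial_tail_rec:
  "m \<le> n \<Longrightarrow> binomial_tail n m p = real (n choose m) * p ^ m * (1 - p) ^ (n - m) + binomial_tail n (Suc m) p"
  unfolding binomial_tail_def by (rule sum.atLeast_Suc_atMost)

lemma choose_Suc_absorb: "Suc m * (n choose Suc m) = (n - m) * (n choose m)"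
  by (simp only: binomial_absorption binomial_absorb_comp)

text \<open>The derivative telescopes. In the derivative of the \<open>i\<close>-th summand the negative part is, by
  absorption, the positive part of summand \<open>i + 1\<close>, so only the positive part of summand \<open>m\<close>
  survives. The induction runs downwards from the empty sum.\<close>

lemma DERIV_binomial_tail:
  assumes "m \<le> n"
  shows "(binomial_tail n m has_real_derivative
           real m * real (n choose m) * p ^ (m - 1) * (1 - p) ^ (n - m)) (at p)"
proof -
  have "m \<le> Suc n" using assms by simp
  then show ?thesis
  proof (induction m rule: inc_induct)
    case base
    have "binomial_tail n (Suc n) = (\<lambda>_. 0)"
      by (auto simp: binomial_tail_def)
    then show ?case by (simp add: binomial_eq_0)
  next
    case (step m)
    let ?d = "real (n choose m) * (real m * p ^ (m - 1) * (1 - p) ^ (n - m)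
                - p ^ m * (real (n - m) * (1 - p) ^ (n - m - 1)))"
    have eq: "(\<lambda>p. real (n choose m) * p ^ m * (1 - p) ^ (n - m) + binomial_tail n (Suc m) p) = binomial_tail n m"
      using step(2) by (intro ext binomial_tail_rec[symmetric]) simp
    have "((\<lambda>p. real (n choose m) * p ^ m * (1 - p) ^ (n - m)) has_real_derivative ?d) (at p)"
      by (auto intro!: derivative_eq_intros simp: algebra_simps)
    note D = DERIV_add[OF this step.IH, unfolded eq]
    have "real (Suc m) * real (n choose Suc m) = real (n - m) * real (n choose m)"
      by (metis choose_Suc_absorb of_nat_mult)
    then have "real (Suc m) * real (n choose Suc m) * p ^ (Suc m - 1) * (1 - p) ^ (n - Suc m)
        = real (n - m) * real (n choose m) * p ^ m * (1 - p) ^ (n - m - 1)"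
      by simp
    then have "?d + real (Suc m) * real (n choose Suc m) * p ^ (Suc m - 1) * (1 - p) ^ (n - Suc m)
        = real m * real (n choose m) * p ^ (m - 1) * (1 - p) ^ (n - m)"
      by (simp only: right_diff_distrib diff_add_cancel mult_ac)
    with D show ?case by (simp only:)
  qed
qed

lemma binomial_tail_borel: "binomial_tail n m \<in> borel_measurable borel"
  unfolding binomial_tail_def by measurable

text \<open>The mean value theorem replaces the difference by \<open>(G x - K x)\<close> times the derivative of the tail
  at a point between \<open>G x\<close> and \<open>K x\<close>. Both are asymptotic to \<open>l * x\<close>, hence so is that point, and
  the derivative there is asymptotic to a multiple of \<open>(l * x) ^ (m - 1)\<close>.\<close>

lemma binomial_tail_diff_tendsto:
  fixes G K :: "real \<Rightarrow> real"
  assumes m: "1 \<le> m" "m \<le> n"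
    and G: "((\<lambda>x. G x / x) \<longlongrightarrow> l) (at_right 0)" and K: "((\<lambda>x. K x / x) \<longlongrightarrow> l) (at_right 0)"
    and D: "((\<lambda>x. (G x - K x) / x ^ Suc r) \<longlongrightarrow> c) (at_right 0)"
  shows "((\<lambda>x. (binomial_tail n m (G x) - binomial_tail n m (K x)) / x ^ (m + r))
      \<longlongrightarrow> real m * real (n choose m) * l ^ (m - 1) * c) (at_right 0)"
proof -
  let ?T = "binomial_tail n m" and ?T' = "\<lambda>p. real m * real (n choose m) * p ^ (m - 1) * (1 - p) ^ (n - m)"
  have "\<exists>z. min (G x) (K x) \<le> z \<and> z \<le> max (G x) (K x) \<and> ?T (G x) - ?T (K x) = (G x - K x) * ?T' z" for x
  proof -
    consider "G x = K x" | "G x < K x" | "K x < G x" by linarith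
    then show ?thesis
    proof cases
      case 1
      then show ?thesis by auto
    next
      case 2
      from MVT2[OF this, of ?T ?T'] DERIV_binomial_tail[OF m(2)]
      obtain z where "G x < z" "z < K x" "?T (K x) - ?T (G x) = (K x - G x) * ?T' z" by blast
      then show ?thesis by (intro exI[of _ z]) (auto simp: algebra_simps)
    next
      case 3
      from MVT2[OF this, of ?T ?T'] DERIV_binomial_tail[OF m(2)]
      obtain z where "K x < z" "z < G x" "?T (G x) - ?T (K x) = (G x - K x) * ?T' z" by blast
      then show ?thesis by (intro exI[of _ z]) auto
    qed
  qed
  then obtain z where z: "\<And>x. min (G x) (K x) \<le> z x" "\<And>x. z x \<le> max (G x) (K x)"
      "\<And>x. ?T (G x) - ?T (K x) = (G x - K x) * ?T' (z x)"
    by metis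
  have pos: "\<forall>\<^sub>F x in at_right (0::real). x > 0"
    by (rule eventually_at_right_less)
  have zl: "((\<lambda>x. z x / x) \<longlongrightarrow> l) (at_right 0)"
  proof (rule tendsto_sandwich)
    show "\<forall>\<^sub>F x in at_right 0. min (G x / x) (K x / x) \<le> z x / x"
      using pos
    proof eventually_elim
      case (elim x)
      with z(1)[of x] show ?case
        by (auto simp: min_def divide_right_mono split: if_splits dest: divide_right_mono[of _ _ x])
    qed
    show "\<forall>\<^sub>F x in at_right 0. z x / x \<le> max (G x / x) (K x / x)"
      using pos
    proof eventually_elim
      case (elim x)
      with z(2)[of x] show ?case
        by (auto simp: max_def divide_right_mono split: if_splits dest: divide_right_mono[of _ _ x])
    qed
    show "((\<lambda>x. min (G x / x) (K x / x)) \<longlongrightarrow> l) (at_right 0)"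
      using tendsto_min[OF G K] by simp
    show "((\<lambda>x. max (G x / x) (K x / x)) \<longlongrightarrow> l) (at_right 0)"
      using tendsto_max[OF G K] by simp
  qed
  have "((\<lambda>x. z x / x * x) \<longlongrightarrow> l * 0) (at_right 0)"
    by (intro tendsto_mult zl) auto
  then have "((\<lambda>x. z x / x * x) \<longlongrightarrow> 0) (at_right 0)" by simp
  then have z0: "(z \<longlongrightarrow> 0) (at_right 0)"
    by (rule Lim_transform_eventually) (use pos in \<open>eventually_elim, simp\<close>)
  have "((\<lambda>x. (G x - K x) / x ^ Suc r * (real m * real (n choose m) * (z x / x) ^ (m - 1) * (1 - z x) ^ (n - m)))
      \<longlongrightarrow> c * (real m * real (n choose m) * l ^ (m - 1) * (1 - 0) ^ (n - m))) (at_right 0)"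
    by (intro tendsto_intros D zl z0)
  then have "((\<lambda>x. (?T (G x) - ?T (K x)) / x ^ (m + r))
      \<longlongrightarrow> c * (real m * real (n choose m) * l ^ (m - 1) * (1 - 0) ^ (n - m))) (at_right 0)"
  proof (rule Lim_transform_eventually)
    show "\<forall>\<^sub>F x in at_right 0. (G x - K x) / x ^ Suc r * (real m * real (n choose m) * (z x / x) ^ (m - 1) * (1 - z x) ^ (n - m))
        = (?T (G x) - ?T (K x)) / x ^ (m + r)"
      using pos
    proof eventually_elim
      case (elim x)
      have "x ^ (m + r) = x ^ Suc r * x ^ (m - 1)"
        using m by (subst power_add[symmetric]) (auto intro: arg_cong[of _ _ "\<lambda>k. x ^ k"])
      then show ?case
        using elim by (simp add: z(3) power_divide field_simps)
    qed
  qed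
  then show ?thesis by (simp add: mult_ac)
qed


section \<open>The exponential solution\<close>

text \<open>The exponential distribution function without the cut-off at negative arguments: it is smooth on
  the whole line and agrees with the true one on \<open>[0, \<infinity>)\<close>.\<close>

definition exp_cdf :: "real \<Rightarrow> real \<Rightarrow> real" where
  "exp_cdf l x = 1 - exp (- l * x)"

lemma exp_cdf_bounds: "l > 0 \<Longrightarrow> x \<ge> 0 \<Longrightarrow> 0 \<le> exp_cdf l x" "exp_cdf l x \<le> 1"
  by (auto simp: exp_cdf_def)

text \<open>Write \<open>H m\<close> for the distribution function of the \<open>m\<close>-th order statistic of an exponential sample.
  It satisfies the linear equation \<open>H (m + 1)' = a * (H m - H (m + 1))\<close> with \<open>a = (n - m) * l\<close>: the
  spacing after the \<open>m\<close>-th order statistic is exponential with rate \<open>a\<close>. Transforming the equation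
  gives the claimed factor.\<close>

lemma laplace_stieltjes_exp_order_stat_Suc:
  assumes m: "1 \<le> m" "m < n" and l: "l > 0" and s: "s > 0"
  shows "laplace_stieltjes (\<lambda>u. binomial_tail n (Suc m) (exp_cdf l u)) s
    = laplace_stieltjes (\<lambda>u. binomial_tail n m (exp_cdf l u)) s * (real (n - m) * l / (real (n - m) * l + s))"
proof -
  let ?H = "\<lambda>m u. binomial_tail n m (exp_cdf l u)"
  define a where "a = real (n - m) * l"
  define h where "h u = a * (?H m u - ?H (Suc m) u)" for u
  have a: "a > 0" using m l by (simp add: a_def)
  have cb: "\<bar>?H m u\<bar> \<le> 1" if "u \<ge> 0" for m u
    using binomial_tail_nonneg[of "exp_cdf l u" n m] binomial_tail_le_1[of "exp_cdf l u" n m] 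
      exp_cdf_bounds(1)[OF l that] exp_cdf_bounds(2)[of l u] by auto
  have cc: "continuous_on UNIV (?H m)" for m
    unfolding binomial_tail_def exp_cdf_def by (intro continuous_intros)
  have [measurable]: "?H m \<in> borel_measurable borel" for m
    by (intro borel_measurable_continuous_onI cc)
  have D: "(?H (Suc m) has_real_derivative h u) (at u)" for u
  proof -
    let ?E = "exp (- l * u)"
    have "(exp_cdf l has_real_derivative l * ?E) (at u)"
      unfolding exp_cdf_def by (auto intro!: derivative_eq_intros)
    from DERIV_chain2[OF DERIV_binomial_tail this, of "Suc m" n] m
    have "(?H (Suc m) has_real_derivative
        real (Suc m) * real (n choose Suc m) * exp_cdf l u ^ m * (1 - exp_cdf l u) ^ (n - Suc m) * (l * ?E)) (at u)"
      by simp
    also have "real (Suc m) * real (n choose Suc m) = real (n - m) * real (n choose m)"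
      by (metis choose_Suc_absorb of_nat_mult)
    also have "real (n - m) * real (n choose m) * exp_cdf l u ^ m * (1 - exp_cdf l u) ^ (n - Suc m) * (l * ?E)
        = a * (real (n choose m) * exp_cdf l u ^ m * ?E ^ Suc (n - Suc m))"
      by (simp add: a_def exp_cdf_def)
    also have "Suc (n - Suc m) = n - m" using m by simp
    also have "a * (real (n choose m) * exp_cdf l u ^ m * ?E ^ (n - m)) = h u"
      unfolding h_def using binomial_tail_rec[of m n "exp_cdf l u"] m by (simp add: exp_cdf_def)
    finally show ?thesis .
  qed
  have "laplace_stieltjes h s = s * laplace_stieltjes (?H (Suc m)) s"
  proof (rule laplace_stieltjes_deriv[OF D _ cb _ _ s, of "2 * a"])
    show "continuous_on UNIV h" unfolding h_def by (intro continuous_intros cc)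
    show "\<bar>h u\<bar> \<le> 2 * a" if "u \<ge> 0" for u
    proof -
      have "\<bar>h u\<bar> = a * \<bar>?H m u - ?H (Suc m) u\<bar>" using a by (simp add: h_def abs_mult)
      also have "\<dots> \<le> a * 2" using a cb[OF that, of m] cb[OF that, of "Suc m"] by (intro mult_left_mono) auto
      finally show ?thesis by simp
    qed
    show "?H (Suc m) 0 = 0" by (simp add: exp_cdf_def binomial_tail_0)
  qed
  moreover have "laplace_stieltjes h s = a * (laplace_stieltjes (?H m) s - laplace_stieltjes (?H (Suc m)) s)"
  proof -
    have "laplace_stieltjes h s = a * laplace_stieltjes (\<lambda>u. ?H m u - ?H (Suc m) u) s"
      unfolding laplace_stieltjes_def h_def by (subst integral_mult_right_zero[symmetric]) (simp only: mult_ac)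
    also have "laplace_stieltjes (\<lambda>u. ?H m u - ?H (Suc m) u) s = laplace_stieltjes (?H m) s - laplace_stieltjes (?H (Suc m)) s"
      by (rule laplace_stieltjes_diff[OF _ cb _ cb s]) auto
    finally show ?thesis .
  qed
  ultimately have "laplace_stieltjes (?H (Suc m)) s * (a + s) = laplace_stieltjes (?H m) s * a"
    by (simp add: algebra_simps)
  then have "laplace_stieltjes (?H (Suc m)) s = laplace_stieltjes (?H m) s * (a / (a + s))"
    using a s by (simp add: field_simps)
  then show ?thesis by (simp only: a_def)
qed

text \<open>Renyi's representation of exponential spacings, in transformed form: the exponential distribution
  solves the equation that is to be characterized. In the index of the product, \<open>i = 1\<close> is the
  last spacing.\<close>

lemma laplace_stieltjes_exp_order_stat:
  assumes m: "1 \<le> m" "m + j \<le> n" and l: "l > 0" and s: "s > 0"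
  shows "laplace_stieltjes (\<lambda>u. binomial_tail n (m + j) (exp_cdf l u)) s
    = laplace_stieltjes (\<lambda>u. binomial_tail n m (exp_cdf l u)) s
      * (\<Prod>i=1..j. (real (n - (m + j) + i) * l / (real (n - (m + j) + i) * l + s)))"
  using m(2)
proof (induction j)
  case 0
  then show ?case by simp
next
  case (Suc j)
  let ?q = "\<lambda>x. x * l / (x * l + s)"
  have "laplace_stieltjes (\<lambda>u. binomial_tail n (m + Suc j) (exp_cdf l u)) s
      = laplace_stieltjes (\<lambda>u. binomial_tail n (m + j) (exp_cdf l u)) s * ?q (real (n - (m + j)))"
    using laplace_stieltjes_exp_order_stat_Suc[of "m + j" n l s] m Suc.prems l s by simp
  also have "\<dots> = laplace_stieltjes (\<lambda>u. binomial_tail n m (exp_cdf l u)) s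
      * ((\<Prod>i=1..j. ?q (real (n - (m + j) + i))) * ?q (real (n - (m + j))))"
    using Suc by simp
  also have "(\<Prod>i=1..j. ?q (real (n - (m + j) + i))) * ?q (real (n - (m + j)))
      = (\<Prod>i=1..Suc j. ?q (real (n - (m + Suc j) + i)))"
  proof -
    \<comment> \<open>Raising \<open>j\<close> shifts the rates by one: the new factor enters at the lower end of the product.\<close>
    have "(\<Prod>i=1..Suc j. ?q (real (n - (m + Suc j) + i)))
        = ?q (real (n - (m + Suc j) + 1)) * (\<Prod>i=Suc 1..Suc j. ?q (real (n - (m + Suc j) + i)))"
      by (rule prod.atLeast_Suc_atMost) simp
    also have "(\<Prod>i=Suc 1..Suc j. ?q (real (n - (m + Suc j) + i)))
        = (\<Prod>i=1..j. ?q (real (n - (m + Suc j) + Suc i)))"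
      by (rule prod.shift_bounds_cl_Suc_ivl)
    also have "n - (m + Suc j) + 1 = n - (m + j)" using Suc.prems by simp
    also have "(\<Prod>i=1..j. ?q (real (n - (m + Suc j) + Suc i))) = (\<Prod>i=1..j. ?q (real (n - (m + j) + i)))"
    proof -
      have "n - (m + Suc j) + Suc i = n - (m + j) + i" for i using Suc.prems by simp
      then show ?thesis by (simp only:)
    qed
    finally show ?thesis by (simp only: mult.commute)
  qed
  finally show ?case .
qed

lemma laplace_stieltjes_exp_cdf:
  assumes l: "l > 0" and s: "s > 0"
  shows "laplace_stieltjes (exp_cdf l) s = l / (l + s)"
proof -
  have cb: "\<bar>exp_cdf l u\<bar> \<le> 1" if "u \<ge> 0" for u
    using exp_cdf_bounds(1)[OF l that] exp_cdf_bounds(2)[of l u] by auto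
  have [measurable]: "exp_cdf l \<in> borel_measurable borel"
    unfolding exp_cdf_def by measurable
  have one: "laplace_stieltjes (\<lambda>_. 1) s = 1"
    using has_bochner_integral_exp_scaled[OF s] by (simp add: laplace_stieltjes_def has_bochner_integral_iff)
  have D: "(exp_cdf l has_real_derivative l * (1 - exp_cdf l u)) (at u)" for u
    unfolding exp_cdf_def by (auto intro!: derivative_eq_intros)
  have "laplace_stieltjes (\<lambda>u. l * (1 - exp_cdf l u)) s = s * laplace_stieltjes (exp_cdf l) s"
  proof (rule laplace_stieltjes_deriv[OF D _ cb _ _ s, of "2 * l"])
    show "\<bar>l * (1 - exp_cdf l u)\<bar> \<le> 2 * l" if "u \<ge> 0" for u
      using exp_cdf_bounds(1)[OF l that] exp_cdf_bounds(2)[of l u] l by (simp add: abs_mult)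
  qed (auto simp: exp_cdf_def intro!: continuous_intros)
  moreover have "laplace_stieltjes (\<lambda>u. l * (1 - exp_cdf l u)) s = l * (1 - laplace_stieltjes (exp_cdf l) s)"
  proof -
    have "laplace_stieltjes (\<lambda>u. l * (1 - exp_cdf l u)) s = l * laplace_stieltjes (\<lambda>u. 1 - exp_cdf l u) s"
      unfolding laplace_stieltjes_def by (subst integral_mult_right_zero[symmetric]) (simp only: mult_ac)
    also have "laplace_stieltjes (\<lambda>u. 1 - exp_cdf l u) s = 1 - laplace_stieltjes (exp_cdf l) s"
      by (subst laplace_stieltjes_diff[OF _ _ _ cb s, of _ 1]) (auto simp: one)
    finally show ?thesis .
  qed
  ultimately have "laplace_stieltjes (exp_cdf l) s * (l + s) = l" by (simp add: algebra_simps)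
  then show ?thesis using l s by (simp add: field_simps)
qed

section \<open>Distribution and transform of order statistics\<close>

lemma sorted_nth_le_iff:
  fixes xs :: "real list"
  assumes "sorted xs" "1 \<le> m" "m \<le> length xs"
  shows "xs ! (m - 1) \<le> x \<longleftrightarrow> m \<le> length (filter (\<lambda>y. y \<le> x) xs)"
proof -
  let ?I = "{i. i < length xs \<and> xs ! i \<le> x}"
  have fin: "finite ?I" by simp
  have "m \<le> card ?I" if "xs ! (m - 1) \<le> x"
  proof -
    have "{..<m} \<subseteq> ?I"
    proof
      fix i assume "i \<in> {..<m}"
      then have "xs ! i \<le> xs ! (m - 1)" using assms by (intro sorted_nth_mono) auto
      then show "i \<in> ?I" using \<open>i \<in> {..<m}\<close> that assms by auto
    qed
    from card_mono[OF fin this] show ?thesis by simp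
  qed
  moreover have "card ?I < m" if "\<not> xs ! (m - 1) \<le> x"
  proof -
    have "?I \<subseteq> {..<m - 1}"
    proof
      fix i assume i: "i \<in> ?I"
      have "xs ! (m - 1) \<le> xs ! i" if "m - 1 \<le> i" using that i assms by (intro sorted_nth_mono) auto
      then show "i \<in> {..<m - 1}" using i \<open>\<not> xs ! (m - 1) \<le> x\<close> by force
    qed
    from card_mono[OF _ this] show ?thesis using assms by simp
  qed
  ultimately show ?thesis by (force simp: length_filter_conv_card)
qed

lemma order_stat_le_iff:
  assumes "1 \<le> m" "m \<le> n"
  shows "order_stat X m n \<omega> \<le> x \<longleftrightarrow> m \<le> card {i\<in>{1..n}. X i \<omega> \<le> x}"
proof -
  let ?xs = "map (\<lambda>i. X i \<omega>) [1..<Suc n]"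
  have "order_stat X m n \<omega> \<le> x \<longleftrightarrow> m \<le> length (filter (\<lambda>y. y \<le> x) (sort ?xs))"
    unfolding order_stat_def by (rule sorted_nth_le_iff) (use assms in auto)
  also have "length (filter (\<lambda>y. y \<le> x) (sort ?xs)) = length (filter (\<lambda>i. X i \<omega> \<le> x) [1..<Suc n])"
    by (simp only: filter_sort length_sort filter_map length_map o_def)
  also have "\<dots> = card (set (filter (\<lambda>i. X i \<omega> \<le> x) [1..<Suc n]))"
    by (intro distinct_card[symmetric]) simp
  also have "set (filter (\<lambda>i. X i \<omega> \<le> x) [1..<Suc n]) = {i\<in>{1..n}. X i \<omega> \<le> x}"
    by auto
  finally show ?thesis .
qed

text \<open>The measure space is arbitrary because the lemma is also needed for the order statistic of the
  coordinates of a product space.\<close>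

lemma borel_measurable_order_stat:
  assumes "1 \<le> m" "m \<le> n" and X: "\<And>i. i \<in> {1..n} \<Longrightarrow> X i \<in> borel_measurable M"
  shows "order_stat X m n \<in> borel_measurable M"
  unfolding borel_measurable_iff_le
proof
  fix x
  have "{\<omega> \<in> space M. order_stat X m n \<omega> \<le> x}
      = (\<Union>S\<in>{S. S \<subseteq> {1..n} \<and> m \<le> card S}. \<Inter>i\<in>{1..n}. {\<omega> \<in> space M. X i \<omega> \<le> x \<longleftrightarrow> i \<in> S})"
  proof (intro set_eqI iffI)
    fix \<omega> assume "\<omega> \<in> {\<omega> \<in> space M. order_stat X m n \<omega> \<le> x}"
    then show "\<omega> \<in> (\<Union>S\<in>{S. S \<subseteq> {1..n} \<and> m \<le> card S}. \<Inter>i\<in>{1..n}. {\<omega> \<in> space M. X i \<omega> \<le> x \<longleftrightarrow> i \<in> S})"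
      using assms(1,2) by (intro UN_I[of "{i\<in>{1..n}. X i \<omega> \<le> x}"]) (auto simp: order_stat_le_iff)
  next
    fix \<omega> assume "\<omega> \<in> (\<Union>S\<in>{S. S \<subseteq> {1..n} \<and> m \<le> card S}. \<Inter>i\<in>{1..n}. {\<omega> \<in> space M. X i \<omega> \<le> x \<longleftrightarrow> i \<in> S})"
    then obtain S where S: "S \<subseteq> {1..n}" "m \<le> card S" and *: "\<And>i. i \<in> {1..n} \<Longrightarrow> \<omega> \<in> space M \<and> (X i \<omega> \<le> x \<longleftrightarrow> i \<in> S)"
      by blast
    have "{i\<in>{1..n}. X i \<omega> \<le> x} = S" using S(1) * by blast
    then show "\<omega> \<in> {\<omega> \<in> space M. order_stat X m n \<omega> \<le> x}"
      using assms(1,2) S(2) *[of 1] by (simp add: order_stat_le_iff)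
  qed
  also have "\<dots> \<in> sets M"
  proof (intro sets.finite_UN sets.finite_INT)
    fix S i assume "i \<in> {1..n}"
    note [measurable] = X[OF this]
    show "{\<omega> \<in> space M. X i \<omega> \<le> x \<longleftrightarrow> i \<in> S} \<in> sets M" by measurable
  qed (use assms(1,2) in auto)
  finally show "{\<omega> \<in> space M. order_stat X m n \<omega> \<le> x} \<in> sets M" .
qed

text \<open>Split the event according to the exact set \<open>S\<close> of indices with \<open>X i \<le> x\<close>. By independence such
  an event has probability \<open>p ^ card S * (1 - p) ^ (n - card S)\<close>, and there are \<open>n choose i\<close> sets
  of size \<open>i\<close>.\<close>

lemma (in prob_space) prob_count_ge:
  fixes X :: "nat \<Rightarrow> 'a \<Rightarrow> real"
  assumes n: "1 \<le> n" and X: "indep_vars (\<lambda>_. borel) X {1..n}"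
    and p: "\<And>i. i \<in> {1..n} \<Longrightarrow> prob {\<omega> \<in> space M. X i \<omega> \<le> x} = p"
  shows "prob {\<omega> \<in> space M. m \<le> card {i\<in>{1..n}. X i \<omega> \<le> x}} = binomial_tail n m p"
proof -
  define E where "E S = {\<omega> \<in> space M. {i\<in>{1..n}. X i \<omega> \<le> x} = S}" for S
  define A where "A S i = (if i \<in> S then {..x} else {x<..})" for S :: "nat set" and i :: nat
  have rv [measurable]: "X i \<in> borel_measurable M" if "i \<in> {1..n}" for i
    using X that by (auto simp: indep_vars_def)
  have E: "E S = (\<Inter>i\<in>{1..n}. X i -` A S i \<inter> space M)" if "S \<subseteq> {1..n}" for S
  proof -
    have "E S = {\<omega> \<in> space M. \<forall>i\<in>{1..n}. X i \<omega> \<le> x \<longleftrightarrow> i \<in> S}"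
      using that unfolding E_def by blast
    also have "\<dots> = {\<omega> \<in> space M. \<forall>i\<in>{1..n}. X i \<omega> \<in> A S i}"
      unfolding A_def by (intro Collect_cong conj_cong ball_cong refl) (simp add: not_le)
    also have "\<dots> = (\<Inter>i\<in>{1..n}. X i -` A S i \<inter> space M)"
      using n by auto
    finally show ?thesis .
  qed
  have pE: "prob (E S) = p ^ card S * (1 - p) ^ (n - card S)" if S: "S \<subseteq> {1..n}" for S
  proof -
    have "prob (E S) = (\<Prod>i\<in>{1..n}. prob (X i -` A S i \<inter> space M))"
      unfolding E[OF S] using n by (intro indep_varsD_finite[OF X]) (auto simp: A_def)
    also have "\<dots> = (\<Prod>i\<in>{1..n}. if i \<in> S then p else 1 - p)"
    proof (rule prod.cong)
      fix i assume i: "i \<in> {1..n}"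
      note [measurable] = rv[OF i]
      have eq: "X i -` {..x} \<inter> space M = {\<omega> \<in> space M. X i \<omega> \<le> x}" by auto
      have "X i -` {x<..} \<inter> space M = space M - {\<omega> \<in> space M. X i \<omega> \<le> x}" by auto
      then have "prob (X i -` {x<..} \<inter> space M) = 1 - p"
        using p[OF i] by (simp add: prob_compl)
      then show "prob (X i -` A S i \<inter> space M) = (if i \<in> S then p else 1 - p)"
        using p[OF i] eq by (simp add: A_def)
    qed simp
    also have "\<dots> = p ^ card S * (1 - p) ^ (n - card S)"
    proof -
      have "{1..n} \<inter> S = S" "card ({1..n} - S) = n - card S"
        using S by (auto simp: card_Diff_subset finite_subset)
      then show ?thesis
        by (simp add: prod.If_cases Diff_eq[symmetric])
    qed
    finally show ?thesis .
  qed
  have Es: "E S \<in> sets M" if "S \<subseteq> {1..n}" for S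
    unfolding E[OF that] using n by (intro sets.finite_INT) (auto simp: A_def intro: measurable_sets[OF rv])
  let ?SS = "{S. S \<subseteq> {1..n} \<and> m \<le> card S}"
  have fin: "finite ?SS" by (rule finite_subset[of _ "Pow {1..n}"]) auto
  have "{\<omega> \<in> space M. m \<le> card {i\<in>{1..n}. X i \<omega> \<le> x}} = (\<Union>S\<in>?SS. E S)"
    by (auto simp: E_def)
  also have "prob \<dots> = (\<Sum>S\<in>?SS. prob (E S))"
    by (intro finite_measure_finite_Union fin) (use Es in \<open>auto simp: disjoint_family_on_def E_def\<close>)
  also have "\<dots> = (\<Sum>S\<in>?SS. p ^ card S * (1 - p) ^ (n - card S))"
    by (intro sum.cong) (auto simp: pE)
  also have "\<dots> = (\<Sum>i=m..n. \<Sum>S\<in>{S\<in>?SS. card S = i}. p ^ card S * (1 - p) ^ (n - card S))"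
    by (rule sum.group[symmetric, OF fin]) (auto dest: card_mono[rotated])
  also have "\<dots> = binomial_tail n m p"
    unfolding binomial_tail_def
  proof (rule sum.cong)
    fix i assume i: "i \<in> {m..n}"
    have "{S\<in>?SS. card S = i} = {S. S \<subseteq> {1..n} \<and> card S = i}" using i by auto
    then have "card {S\<in>?SS. card S = i} = n choose i"
      using n_subsets[of "{1..n}" i] by simp
    then show "(\<Sum>S\<in>{S\<in>?SS. card S = i}. p ^ card S * (1 - p) ^ (n - card S))
        = real (n choose i) * p ^ i * (1 - p) ^ (n - i)"
      by simp
  qed simp
  finally show ?thesis .
qed

lemma (in prob_space) cdf_order_stat:
  assumes m: "1 \<le> m" "m \<le> n" and X: "indep_vars (\<lambda>_. borel) X {1..n}"
    and F: "\<And>i. i \<in> {1..n} \<Longrightarrow> cdf (distr M borel (X i)) = F"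
  shows "cdf (distr M borel (order_stat X m n)) x = binomial_tail n m (F x)"
proof -
  have rv: "X i \<in> borel_measurable M" if "i \<in> {1..n}" for i
    using X that by (auto simp: indep_vars_def)
  have "prob {\<omega> \<in> space M. X i \<omega> \<le> x} = F x" if "i \<in> {1..n}" for i
    unfolding F[OF that, symmetric] cdf_def using rv[OF that]
    by (subst measure_distr) (auto intro!: arg_cong[of _ _ prob])
  from prob_count_ge[OF _ X this, of m] m
  have "prob {\<omega> \<in> space M. m \<le> card {i\<in>{1..n}. X i \<omega> \<le> x}} = binomial_tail n m (F x)" by simp
  also have "{\<omega> \<in> space M. m \<le> card {i\<in>{1..n}. X i \<omega> \<le> x}} = order_stat X m n -` {..x} \<inter> space M"
    using m by (auto simp: order_stat_le_iff)
  also have "prob \<dots> = cdf (distr M borel (order_stat X m n)) x"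
    unfolding cdf_def using borel_measurable_order_stat[OF m rv] by (subst measure_distr) auto
  finally show ?thesis by simp
qed

text \<open>Write \<open>exp (- s * x)\<close> as the integral of \<open>s * exp (- s * u)\<close> over \<open>u \<ge> x\<close> and exchange the
  integrals; the inner one then becomes \<open>cdf N u\<close>.\<close>

lemma laplace_stieltjes_cdf:
  assumes "real_distribution N" and N0: "cdf N 0 = 0" and s: "s > 0"
  shows "(\<integral>x. exp (- s * x) \<partial>N) = laplace_stieltjes (cdf N) s"
    and "integrable N (\<lambda>x. exp (- s * x))"
proof -
  interpret real_distribution N by fact
  interpret pair_sigma_finite N lborel ..
  have sN: "sets N = sets borel" by simp
  note [measurable_cong] = sN
  have [measurable]: "cdf N \<in> borel_measurable borel"
    by (rule borel_measurable_mono) (simp add: mono_def cdf_nondecreasing)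
  have AE0: "AE x in N. x > 0"
  proof -
    have "prob {..0} = 0" using N0 by (simp add: cdf_def)
    then have "AE x in N. x \<notin> {..0}" by (intro AE_not_in) (auto simp: null_sets_def emeasure_eq_measure)
    then show ?thesis by eventually_elim auto
  qed
  let ?g = "\<lambda>x u. ennreal (if x \<le> u \<and> 0 \<le> u then s * exp (- s * u) else 0)"
  have inner: "(\<integral>\<^sup>+u. ?g x u \<partial>lborel) = ennreal (exp (- s * x))" if "x > 0" for x
  proof -
    have "(\<integral>\<^sup>+u. ?g x u \<partial>lborel) = (\<integral>\<^sup>+u. ennreal (s * exp (- s * u)) * indicator {x..} u \<partial>lborel)"
      using that by (intro nn_integral_cong) (auto simp: indicator_def)
    also have "\<dots> = ennreal (0 - (- exp (- s * x)))"
    proof (rule nn_integral_FTC_atLeast)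
      show "((\<lambda>u. - exp (- s * u)) has_real_derivative s * exp (- s * u)) (at u)" for u
        by (auto intro!: derivative_eq_intros)
      have "((\<lambda>u. exp (- s * u)) \<longlongrightarrow> 0) at_top"
        using s by (intro filterlim_compose[OF exp_at_bot]
            filterlim_tendsto_neg_mult_at_bot[OF tendsto_const] filterlim_ident) auto
      from tendsto_minus[OF this] show "((\<lambda>u. - exp (- s * u)) \<longlongrightarrow> 0) at_top" by simp
    qed (use s in auto)
    finally show ?thesis by simp
  qed
  have outer: "(\<integral>\<^sup>+x. ?g x u \<partial>N) = ennreal (indicator {0..} u * (s * exp (- s * u) * cdf N u))" for u
  proof -
    have "(\<integral>\<^sup>+x. ?g x u \<partial>N) = (\<integral>\<^sup>+x. ennreal (indicator {0..} u * (s * exp (- s * u))) * indicator {..u} x \<partial>N)"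
      by (intro nn_integral_cong) (auto simp: indicator_def)
    also have "\<dots> = ennreal (indicator {0..} u * (s * exp (- s * u))) * emeasure N {..u}"
      by (intro nn_integral_cmult_indicator) auto
    also have "\<dots> = ennreal (indicator {0..} u * (s * exp (- s * u) * cdf N u))"
      using s by (simp add: emeasure_eq_measure cdf_def ennreal_mult' mult_ac flip: ennreal_mult')
    finally show ?thesis .
  qed
  have "(\<integral>\<^sup>+x. ennreal (exp (- s * x)) \<partial>N) = (\<integral>\<^sup>+x. \<integral>\<^sup>+u. ?g x u \<partial>lborel \<partial>N)"
    using AE0 by (intro nn_integral_cong_AE) (auto simp: inner)
  also have "\<dots> = (\<integral>\<^sup>+u. \<integral>\<^sup>+x. ?g x u \<partial>N \<partial>lborel)"
    by (rule Fubini'[symmetric]) measurable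
  also have "\<dots> = (\<integral>\<^sup>+u. ennreal (indicator {0..} u * (s * exp (- s * u) * cdf N u)) \<partial>lborel)"
    by (simp only: outer)
  finally have *: "(\<integral>\<^sup>+x. ennreal (exp (- s * x)) \<partial>N)
      = (\<integral>\<^sup>+u. ennreal (indicator {0..} u * (s * exp (- s * u) * cdf N u)) \<partial>lborel)" .
  show "(\<integral>x. exp (- s * x) \<partial>N) = laplace_stieltjes (cdf N) s"
    unfolding laplace_stieltjes_def
    by (subst (1 2) integral_eq_nn_integral) (use s * cdf_nonneg in \<open>auto intro!: AE_I2\<close>)
  show "integrable N (\<lambda>x. exp (- s * x))"
  proof (rule integrable_const_bound[where B = 1])
    show "AE x in N. norm (exp (- s * x)) \<le> 1"
      using AE0 by eventually_elim (use s in auto)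
  qed measurable
qed

lemma (in prob_space) expectation_exp_eq_laplace_stieltjes:
  assumes [measurable]: "X \<in> borel_measurable M" and X0: "cdf (distr M borel X) 0 = 0" and s: "s > 0"
  shows "expectation (\<lambda>\<omega>. exp (- s * X \<omega>)) = laplace_stieltjes (cdf (distr M borel X)) s"
    and "integrable M (\<lambda>\<omega>. exp (- s * X \<omega>))"
proof -
  have "real_distribution (distr M borel X)" by (rule real_distribution_distr) measurable
  note * = laplace_stieltjes_cdf[OF this X0 s]
  show "expectation (\<lambda>\<omega>. exp (- s * X \<omega>)) = laplace_stieltjes (cdf (distr M borel X)) s"
    using *(1) by (subst (asm) integral_distr) auto
  show "integrable M (\<lambda>\<omega>. exp (- s * X \<omega>))"
    using *(2) by (subst (asm) integrable_distr_eq) auto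
qed

text \<open>The equation in distribution enters the proof only through this identity of transforms, in which
  independence has turned the sum into a product.\<close>

lemma (in prob_space) laplace_stieltjes_order_stat_identity:
  fixes X X0 :: "nat \<Rightarrow> 'a \<Rightarrow> real" and a :: "nat \<Rightarrow> real"
  assumes m: "1 \<le> m" "m \<le> n" and k: "1 \<le> k" "k \<le> n" and F0: "F 0 = 0"
    and X: "indep_vars (\<lambda>_. borel) X {1..n}"
    and XF: "\<And>i. i \<in> {1..n} \<Longrightarrow> cdf (distr M borel (X i)) = F"
    and X0: "indep_vars (\<lambda>_. borel) X0 {1..j}"
    and X0F: "\<And>i. i \<in> {1..j} \<Longrightarrow> cdf (distr M borel (X0 i)) = F"
    and ind: "indep_var (PiM {1..n} (\<lambda>_. borel)) (\<lambda>\<omega>. \<lambda>i\<in>{1..n}. X i \<omega>)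
           (PiM {1..j} (\<lambda>_. borel)) (\<lambda>\<omega>. \<lambda>i\<in>{1..j}. X0 i \<omega>)"
    and a: "\<And>i. i \<in> {1..j} \<Longrightarrow> a i > 0"
    and eq: "eq_in_dist M (\<lambda>\<omega>. order_stat X m n \<omega> + (\<Sum>i=1..j. 1 / a i * X0 i \<omega>)) (order_stat X k n)"
    and s: "s > 0"
  shows "laplace_stieltjes (\<lambda>u. binomial_tail n k (F u)) s
     = laplace_stieltjes (\<lambda>u. binomial_tail n m (F u)) s * (\<Prod>i=1..j. laplace_stieltjes F (s / a i))"
proof -
  have rvX: "X i \<in> borel_measurable M" if "i \<in> {1..n}" for i
    using X that by (auto simp: indep_vars_def)
  have rvX0 [measurable]: "X0 i \<in> borel_measurable M" if "i \<in> {1..j}" for i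
    using X0 that by (auto simp: indep_vars_def)
  have mm [measurable]: "order_stat X m n \<in> borel_measurable M" "order_stat X k n \<in> borel_measurable M"
    using borel_measurable_order_stat m k rvX by blast+
  have cdf: "cdf (distr M borel (order_stat X l n)) = (\<lambda>u. binomial_tail n l (F u))" if "1 \<le> l" "l \<le> n" for l
    using cdf_order_stat[OF that X XF] by blast
  have lapX: "expectation (\<lambda>\<omega>. exp (- s * order_stat X l n \<omega>)) = laplace_stieltjes (\<lambda>u. binomial_tail n l (F u)) s"
     "integrable M (\<lambda>\<omega>. exp (- s * order_stat X l n \<omega>))" if "1 \<le> l" "l \<le> n" for l
    using expectation_exp_eq_laplace_stieltjes[of "order_stat X l n" s] cdf[OF that] s F0 that binomial_tail_0[of l n]
      borel_measurable_order_stat[OF that rvX] by auto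
  have lap0: "expectation (\<lambda>\<omega>. exp (- (s / a i) * X0 i \<omega>)) = laplace_stieltjes F (s / a i)"
     "integrable M (\<lambda>\<omega>. exp (- (s / a i) * X0 i \<omega>))" if "i \<in> {1..j}" for i
    using expectation_exp_eq_laplace_stieltjes[of "X0 i" "s / a i"] X0F[OF that] s F0 a[OF that] rvX0[OF that] by auto
  let ?Z = "\<lambda>\<omega>. \<Prod>i\<in>{1..j}. exp (- (s / a i) * X0 i \<omega>)"
  have ind0: "indep_vars (\<lambda>_. borel) (\<lambda>i \<omega>. exp (- (s / a i) * X0 i \<omega>)) {1..j}"
    by (rule indep_vars_compose2[OF X0, where Y = "\<lambda>i x. exp (- (s / a i) * x)"]) measurable
  have Z: "expectation ?Z = (\<Prod>i\<in>{1..j}. laplace_stieltjes F (s / a i))" "integrable M ?Z"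
    using indep_vars_lebesgue_integral[OF _ ind0] indep_vars_integrable[OF _ ind0] lap0 by auto
  \<comment> \<open>The order statistic depends on the sample only, the remaining factors on the other vector only.\<close>
  have "indep_var borel
      ((\<lambda>v. exp (- s * order_stat (\<lambda>i v. v i) m n v)) \<circ> (\<lambda>\<omega>. \<lambda>i\<in>{1..n}. X i \<omega>))
      borel ((\<lambda>v. \<Prod>i\<in>{1..j}. exp (- (s / a i) * v i)) \<circ> (\<lambda>\<omega>. \<lambda>i\<in>{1..j}. X0 i \<omega>))"
  proof (rule indep_var_compose[OF ind])
    have [measurable]: "order_stat (\<lambda>i v. v i) m n \<in> borel_measurable (PiM {1..n} (\<lambda>_. borel))"
      using m by (intro borel_measurable_order_stat) measurable
    show "(\<lambda>v. exp (- s * order_stat (\<lambda>i v. v i) m n v)) \<in> borel_measurable (PiM {1..n} (\<lambda>_. borel))"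
      by measurable
    show "(\<lambda>v. \<Prod>i\<in>{1..j}. exp (- (s / a i) * v i)) \<in> borel_measurable (PiM {1..j} (\<lambda>_. borel))"
      by measurable
  qed
  moreover have "order_stat (\<lambda>i v. v i) m n (\<lambda>i\<in>{1..n}. X i \<omega>) = order_stat X m n \<omega>" for \<omega>
    unfolding order_stat_def by (intro arg_cong[of _ _ "\<lambda>xs. sort xs ! (m - 1)"] map_cong) auto
  moreover have "(\<Prod>i\<in>{1..j}. exp (- (s / a i) * (\<lambda>i\<in>{1..j}. X0 i \<omega>) i)) = ?Z \<omega>" for \<omega>
    by (rule prod.cong) auto
  ultimately have ind': "indep_var borel (\<lambda>\<omega>. exp (- s * order_stat X m n \<omega>)) borel ?Z"
    by (simp only: o_def)
  let ?U = "\<lambda>\<omega>. order_stat X m n \<omega> + (\<Sum>i=1..j. 1 / a i * X0 i \<omega>)"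
  have [measurable]: "?U \<in> borel_measurable M" by measurable
  have "laplace_stieltjes (\<lambda>u. binomial_tail n k (F u)) s = (\<integral>x. exp (- s * x) \<partial>distr M borel (order_stat X k n))"
    using lapX(1)[OF k] by (subst integral_distr) auto
  also have "\<dots> = (\<integral>x. exp (- s * x) \<partial>distr M borel ?U)"
    using eq by (simp add: eq_in_dist_def)
  also have "\<dots> = expectation (\<lambda>\<omega>. exp (- s * ?U \<omega>))"
    by (subst integral_distr) auto
  also have "(\<lambda>\<omega>. exp (- s * ?U \<omega>)) = (\<lambda>\<omega>. exp (- s * order_stat X m n \<omega>) * ?Z \<omega>)"
    by (auto simp: fun_eq_iff exp_add[symmetric] exp_sum[symmetric] algebra_simps sum_distrib_left sum_negf)
  also have "expectation \<dots> = expectation (\<lambda>\<omega>. exp (- s * order_stat X m n \<omega>)) * expectation ?Z"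
    by (rule indep_var_lebesgue_integral[OF ind' lapX(2)[OF m] Z(2)])
  finally show ?thesis using lapX(1)[OF m] Z(1) by simp
qed

section \<open>A factorial inequality\<close>

text \<open>The factor \<open>l + i\<close> of the rising factorial is at most \<open>i * (l + 1)\<close>.\<close>

lemma fact_add_le: "fact (l + r) \<le> (fact r * fact l * (real l + 1) ^ r :: real)"
proof (induction r)
  case (Suc r)
  have "(fact (l + Suc r) :: real) = (real l + real r + 1) * fact (l + r)"
    by (simp add: algebra_simps)
  also have "\<dots> \<le> ((real r + 1) * (real l + 1)) * (fact r * fact l * (real l + 1) ^ r)"
    by (intro mult_mono Suc.IH) (auto simp: algebra_simps)
  also have "\<dots> = fact (Suc r) * fact l * (real l + 1) ^ Suc r"
    by (simp add: algebra_simps)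
  finally show ?case .
qed simp

text \<open>The increment from \<open>j\<close> to \<open>j + 1\<close> of the left-hand side is \<open>(r + 1) * fact (l + r) / fact l\<close> for
  \<open>l = m + j\<close>, a rising factorial that the previous lemma compares with a power of \<open>l + 1\<close>.\<close>

lemma fact_quotient_le:
  assumes "m \<ge> 1"
  shows "fact (m + j + r) / fact (m + j - 1)
    \<le> fact (m + r) / fact (m - 1) + fact (r + 1) * (\<Sum>i=1..j. real (m + i) ^ r)"
proof (induction j)
  case (Suc j)
  define l where "l = m + j"
  have l: "fact l = real l * fact (l - 1)"
    using assms by (subst fact_reduce) (auto simp: l_def)
  have "fact (Suc l + r) / fact l = (real l * fact (l + r) + (real r + 1) * fact (l + r)) / fact l"
    by (simp add: algebra_simps)
  also have "\<dots> = fact (l + r) / fact (l - 1) + (real r + 1) * (fact (l + r) / fact l)"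
    using assms by (simp add: l add_divide_distrib) (simp add: l_def)
  also have "fact (l + r) / fact l \<le> fact r * (real l + 1) ^ r"
    using fact_add_le[of l r] by (simp add: field_simps)
  also have "(real r + 1) * (fact r * (real l + 1) ^ r) = fact (r + 1) * real (m + Suc j) ^ r"
    by (simp add: l_def algebra_simps)
  finally have "fact (Suc l + r) / fact l \<le> fact (l + r) / fact (l - 1) + fact (r + 1) * real (m + Suc j) ^ r"
    by (simp add: mult_left_mono)
  with Suc.IH show ?case
    by (simp add: l_def algebra_simps)
qed simp

text \<open>These are the first-order effects of a perturbation on the two sides of the equation, so the
  strict inequality is what excludes a perturbation. With \<open>b = n - k\<close> and \<open>k = m + j\<close> the
  hypothesis \<open>m < b\<close> reads \<open>k < (n + j) / 2\<close>. Strictness needs \<open>r \<ge> 1\<close>: for \<open>r = 0\<close> both sides agree,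
  as the scale parameter is free.\<close>

lemma fact_quotient_less:
  assumes "m \<ge> 1" "j \<ge> 1" "r \<ge> 1" and b: "real m < b"
  shows "fact (m + j + r) / fact (m + j - 1)
    < fact (m + r) / fact (m - 1) + fact (r + 1) * (\<Sum>i=1..j. (b + real i) ^ r)"
proof -
  have "(\<Sum>i=1..j. real (m + i) ^ r) < (\<Sum>i=1..j. (b + real i) ^ r)"
    using assms by (intro sum_strict_mono power_strict_mono) auto
  then have "fact (r + 1) * (\<Sum>i=1..j. real (m + i) ^ r) < fact (r + 1) * (\<Sum>i=1..j. (b + real i) ^ r)"
    by (intro mult_strict_left_mono) auto
  with fact_quotient_le[OF assms(1), of j r] show ?thesis by linarith
qed


section \<open>The effect of a leading-order perturbation\<close>

lemma binomial_tail_tendsto: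
  fixes G :: "real \<Rightarrow> real"
  assumes m: "m \<le> n" and G: "((\<lambda>x. G x / x) \<longlongrightarrow> l) (at_right 0)"
  shows "((\<lambda>x. binomial_tail n m (G x) / x ^ m) \<longlongrightarrow> real (n choose m) * l ^ m) (at_right 0)"
proof -
  have pos: "\<forall>\<^sub>F x in at_right (0::real). x > 0"
    by (rule eventually_at_right_less)
  have "((\<lambda>x. G x / x * x) \<longlongrightarrow> l * 0) (at_right 0)"
    by (intro tendsto_mult G) auto
  then have "((\<lambda>x. G x / x * x) \<longlongrightarrow> 0) (at_right 0)" by simp
  then have G0: "(G \<longlongrightarrow> 0) (at_right 0)"
    by (rule Lim_transform_eventually) (use pos in \<open>eventually_elim, simp\<close>)
  have "((\<lambda>x. \<Sum>i=m..n. real (n choose i) * (G x / x) ^ m * G x ^ (i - m) * (1 - G x) ^ (n - i))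
      \<longlongrightarrow> (\<Sum>i=m..n. real (n choose i) * l ^ m * 0 ^ (i - m) * (1 - 0) ^ (n - i))) (at_right 0)"
    by (intro tendsto_intros G G0)
  also have "(\<Sum>i=m..n. real (n choose i) * l ^ m * 0 ^ (i - m) * (1 - 0) ^ (n - i)) = real (n choose m) * l ^ m"
  proof -
    have "(\<Sum>i=m..n. real (n choose i) * l ^ m * 0 ^ (i - m) * (1 - 0) ^ (n - i))
        = (\<Sum>i=m..n. if i = m then real (n choose m) * l ^ m else 0)"
      by (intro sum.cong) auto
    then show ?thesis using m by simp
  qed
  finally show ?thesis
  proof (rule Lim_transform_eventually)
    show "\<forall>\<^sub>F x in at_right 0. (\<Sum>i=m..n. real (n choose i) * (G x / x) ^ m * G x ^ (i - m) * (1 - G x) ^ (n - i))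
        = binomial_tail n m (G x) / x ^ m"
      using pos
    proof eventually_elim
      case (elim x)
      show ?case unfolding binomial_tail_def sum_divide_distrib
      proof (rule sum.cong)
        fix i assume "i \<in> {m..n}"
        then have "G x ^ i = G x ^ m * G x ^ (i - m)" by (simp flip: power_add)
        then show "real (n choose i) * (G x / x) ^ m * G x ^ (i - m) * (1 - G x) ^ (n - i)
            = real (n choose i) * G x ^ i * (1 - G x) ^ (n - i) / x ^ m"
          by (simp add: power_divide)
      qed simp
    qed
  qed
qed

lemma exp_cdf_tendsto: "((\<lambda>x. exp_cdf l x / x) \<longlongrightarrow> l) (at_right 0)"
proof -
  have "(exp_cdf l has_real_derivative l) (at 0)"
    unfolding exp_cdf_def by (auto intro!: derivative_eq_intros)
  then have "((\<lambda>x. exp_cdf l x / x) \<longlongrightarrow> l) (at 0)"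
    by (simp add: DERIV_def exp_cdf_def)
  then show ?thesis by (rule tendsto_within_subset) simp
qed

lemma exp_cdf_borel [measurable]: "exp_cdf l \<in> borel_measurable borel"
  unfolding exp_cdf_def by measurable

text \<open>If \<open>F\<close> deviates from the exponential distribution function by \<open>c * x ^ (r + 1)\<close> to leading order,
  then the transform of its \<open>m\<close>-th order statistic deviates from the exponential one by a relative
  error of order \<open>1 / s ^ r\<close>, with this explicit constant. Numerator and denominator come from the
  Abelian theorem with exponents \<open>m + r\<close> and \<open>m\<close>.\<close>

lemma laplace_stieltjes_ratio_tendsto:
  fixes F :: "real \<Rightarrow> real"
  assumes m: "1 \<le> m" "m \<le> n" and l: "l > 0" and r: "r \<ge> 1"
    and F [measurable]: "F \<in> borel_measurable borel" and F01: "\<And>x. 0 \<le> F x" "\<And>x. F x \<le> 1"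
    and D: "((\<lambda>x. (F x - exp_cdf l x) / x ^ Suc r) \<longlongrightarrow> c) (at_right 0)"
  shows "((\<lambda>s. s ^ r * (laplace_stieltjes (\<lambda>u. binomial_tail n m (F u)) s / laplace_stieltjes (\<lambda>u. binomial_tail n m (exp_cdf l u)) s - 1))
      \<longlongrightarrow> c / l * (fact (m + r) / fact (m - 1))) at_top"
    and "\<forall>\<^sub>F s in at_top. laplace_stieltjes (\<lambda>u. binomial_tail n m (exp_cdf l u)) s \<noteq> 0"
proof -
  let ?H = "\<lambda>u. binomial_tail n m (F u)" and ?K = "\<lambda>u. binomial_tail n m (exp_cdf l u)"
  note binomial_tail_borel [measurable]
  have bH: "\<bar>?H u\<bar> \<le> 1" if "u \<ge> 0" for u
    using binomial_tail_nonneg[of "F u" n m] binomial_tail_le_1[of "F u" n m] F01 by simp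
  have bK: "\<bar>?K u\<bar> \<le> 1" if "u \<ge> 0" for u
    using binomial_tail_nonneg[of "exp_cdf l u" n m] binomial_tail_le_1[of "exp_cdf l u" n m]
      exp_cdf_bounds(1)[OF l that] exp_cdf_bounds(2)[of l u] by simp
  have pos: "\<forall>\<^sub>F x in at_right (0::real). x > 0"
    by (rule eventually_at_right_less)
  have Fl: "((\<lambda>x. F x / x) \<longlongrightarrow> l) (at_right 0)"
  proof -
    have "((\<lambda>x. exp_cdf l x / x + (F x - exp_cdf l x) / x ^ Suc r * x ^ r) \<longlongrightarrow> l + c * 0 ^ r) (at_right 0)"
      by (intro tendsto_intros exp_cdf_tendsto D)
    moreover have "l + c * 0 ^ r = l" using r by simp
    ultimately have "((\<lambda>x. exp_cdf l x / x + (F x - exp_cdf l x) / x ^ Suc r * x ^ r) \<longlongrightarrow> l) (at_right 0)"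
      by (simp only:)
    then show ?thesis
      by (rule Lim_transform_eventually)
         (use pos in \<open>eventually_elim, simp add: field_simps\<close>)
  qed
  have "((\<lambda>s. s ^ (m + r) * laplace_stieltjes (\<lambda>u. ?H u - ?K u) s)
      \<longlongrightarrow> real m * real (n choose m) * l ^ (m - 1) * c * fact (m + r)) at_top"
  proof (rule laplace_stieltjes_abelian)
    show "\<bar>?H u - ?K u\<bar> \<le> 2" if "u \<ge> 0" for u using bH[OF that] bK[OF that] by linarith
    show "((\<lambda>x. (?H x - ?K x) / x ^ (m + r)) \<longlongrightarrow> real m * real (n choose m) * l ^ (m - 1) * c) (at_right 0)"
      by (rule binomial_tail_diff_tendsto[OF m Fl exp_cdf_tendsto D])
  qed measurable
  moreover have "\<forall>\<^sub>F s in at_top. laplace_stieltjes (\<lambda>u. ?H u - ?K u) s = laplace_stieltjes ?H s - laplace_stieltjes ?K s"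
    using eventually_gt_at_top[of 0] by eventually_elim (rule laplace_stieltjes_diff[OF _ bH _ bK], auto)
  ultimately have A: "((\<lambda>s. s ^ (m + r) * (laplace_stieltjes ?H s - laplace_stieltjes ?K s))
      \<longlongrightarrow> real m * real (n choose m) * l ^ (m - 1) * c * fact (m + r)) at_top"
    by (rule Lim_transform_eventually[OF _ eventually_mono]) simp
  have B: "((\<lambda>s. s ^ m * laplace_stieltjes ?K s) \<longlongrightarrow> real (n choose m) * l ^ m * fact m) at_top"
    by (rule laplace_stieltjes_abelian[OF _ bK binomial_tail_tendsto[OF m(2) exp_cdf_tendsto]]) auto
  have Bpos: "real (n choose m) * l ^ m * fact m > 0" using m l by simp
  have "\<forall>\<^sub>F s in at_top. s ^ m * laplace_stieltjes ?K s > 0"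
    using order_tendstoD(1)[OF B Bpos] .
  then show nz: "\<forall>\<^sub>F s in at_top. laplace_stieltjes ?K s \<noteq> 0"
    by eventually_elim auto
  have "((\<lambda>s. s ^ (m + r) * (laplace_stieltjes ?H s - laplace_stieltjes ?K s) / (s ^ m * laplace_stieltjes ?K s))
      \<longlongrightarrow> real m * real (n choose m) * l ^ (m - 1) * c * fact (m + r) / (real (n choose m) * l ^ m * fact m)) at_top"
    by (intro tendsto_divide A B less_imp_neq[OF Bpos, symmetric])
  also have "real m * real (n choose m) * l ^ (m - 1) * c * fact (m + r) / (real (n choose m) * l ^ m * fact m)
      = c / l * (fact (m + r) / fact (m - 1))"
  proof -
    have "fact m = (real m * fact (m - 1) :: real)" "l ^ m = l * l ^ (m - 1)"
      using m by (auto simp: fact_reduce power_eq_if)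
    then show ?thesis using m l by simp
  qed
  finally show "((\<lambda>s. s ^ r * (laplace_stieltjes ?H s / laplace_stieltjes ?K s - 1)) \<longlongrightarrow> c / l * (fact (m + r) / fact (m - 1))) at_top"
  proof (rule Lim_transform_eventually)
    show "\<forall>\<^sub>F s in at_top. s ^ (m + r) * (laplace_stieltjes ?H s - laplace_stieltjes ?K s) / (s ^ m * laplace_stieltjes ?K s) = s ^ r * (laplace_stieltjes ?H s / laplace_stieltjes ?K s - 1)"
      using nz eventually_gt_at_top[of 0]
      by eventually_elim (simp add: power_add field_simps)
  qed
qed

text \<open>Relative errors of order \<open>1 / s ^ r\<close> add up when factors are multiplied.\<close>

lemma prod_perturbation_tendsto:
  fixes R :: "'i \<Rightarrow> real \<Rightarrow> real"
  assumes "finite I" and r: "r \<ge> 1"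
    and R: "\<And>i. i \<in> I \<Longrightarrow> ((\<lambda>s. s ^ r * (R i s - 1)) \<longlongrightarrow> \<alpha> i) at_top"
  shows "((\<lambda>s. s ^ r * ((\<Prod>i\<in>I. R i s) - 1)) \<longlongrightarrow> (\<Sum>i\<in>I. \<alpha> i)) at_top"
  using assms(1) R
proof (induction I)
  case (insert i I)
  have Ri: "((\<lambda>s. s ^ r * (R i s - 1)) \<longlongrightarrow> \<alpha> i) at_top" using insert.prems by simp
  have IH: "((\<lambda>s. s ^ r * ((\<Prod>i\<in>I. R i s) - 1)) \<longlongrightarrow> (\<Sum>i\<in>I. \<alpha> i)) at_top"
    using insert by simp
  have "((\<lambda>s. s ^ r * (R i s - 1) / s ^ r + 1) \<longlongrightarrow> 0 + 1) at_top"
    using r by (intro tendsto_add tendsto_const tendsto_divide_0[OF Ri] filterlim_at_top_imp_at_infinity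
        filterlim_pow_at_top filterlim_ident) auto
  then have "((\<lambda>s. s ^ r * (R i s - 1) / s ^ r + 1) \<longlongrightarrow> 1) at_top" by simp
  then have R1: "(R i \<longlongrightarrow> 1) at_top"
    by (rule Lim_transform_eventually) (use eventually_gt_at_top[of 0] in \<open>eventually_elim, simp\<close>)
  have "((\<lambda>s. s ^ r * (R i s - 1) + R i s * (s ^ r * ((\<Prod>i\<in>I. R i s) - 1)))
      \<longlongrightarrow> \<alpha> i + 1 * (\<Sum>i\<in>I. \<alpha> i)) at_top"
    by (intro tendsto_add tendsto_mult Ri R1 IH)
  then show ?case using insert.hyps by (simp add: algebra_simps)
qed simp

text \<open>Divide the transformed equation for \<open>F\<close> by the one that the exponential distribution satisfies,
  and compare relative errors of order \<open>1 / s ^ r\<close>. The left side contributes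
  \<open>c / l * fact (k + r) / fact (k - 1)\<close>; the right side contributes the same expression for \<open>m\<close> in place
  of \<open>k = m + j\<close>, plus \<open>c / l * fact (r + 1) * a ^ r\<close> for each scaled summand. The factorial
  inequality says that these totals can agree only for \<open>c = 0\<close>.\<close>

lemma perturbation_vanishes:
  fixes F :: "real \<Rightarrow> real"
  assumes m: "1 \<le> m" and j: "1 \<le> j" and n: "2 * m + j < n"
    and l: "l > 0" and r: "r \<ge> 1"
    and F: "F \<in> borel_measurable borel" and F01: "\<And>x. 0 \<le> F x" "\<And>x. F x \<le> 1"
    and rel: "\<And>s. s > 0 \<Longrightarrow> laplace_stieltjes (\<lambda>u. binomial_tail n (m + j) (F u)) s
     = laplace_stieltjes (\<lambda>u. binomial_tail n m (F u)) s * (\<Prod>i=1..j. laplace_stieltjes F (s / real (n - (m + j) + i)))"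
    and D: "((\<lambda>x. (F x - exp_cdf l x) / x ^ Suc r) \<longlongrightarrow> c) (at_right 0)"
  shows "c = 0"
proof (rule ccontr)
  assume c: "c \<noteq> 0"
  define k where "k = m + j"
  define a where "a i = real (n - k + i)" for i
  define R where "R m s = laplace_stieltjes (\<lambda>u. binomial_tail n m (F u)) s / laplace_stieltjes (\<lambda>u. binomial_tail n m (exp_cdf l u)) s" for m s
  define Q where "Q s = laplace_stieltjes F s / laplace_stieltjes (exp_cdf l) s" for s
  have kn: "1 \<le> k" "k < n" "m < n" using m n by (auto simp: k_def)
  have gap: "real m < real (n - k)" using n by (simp add: k_def)
  have a: "a i > 0" for i using kn by (simp add: a_def)
  note ratio = laplace_stieltjes_ratio_tendsto[OF _ _ l r F F01 D]
  have Rlim: "((\<lambda>s. s ^ r * (R q s - 1)) \<longlongrightarrow> c / l * (fact (q + r) / fact (q - 1))) at_top"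
    if "1 \<le> q" "q \<le> n" for q
    unfolding R_def by (rule ratio(1)[OF that])
  \<comment> \<open>A single variable is the order statistic of a sample of size \<open>1\<close>.\<close>
  have bt1: "binomial_tail 1 1 = (\<lambda>p. p)" by (auto simp: binomial_tail_def)
  have Q0: "((\<lambda>s. s ^ r * (Q s - 1)) \<longlongrightarrow> c / l * fact (r + 1)) at_top"
    using ratio(1)[of 1 1] unfolding bt1 Q_def by simp
  have Qlim: "((\<lambda>s. s ^ r * (Q (s / a i) - 1)) \<longlongrightarrow> c / l * fact (r + 1) * a i ^ r) at_top" for i
  proof -
    have "filterlim (\<lambda>s. s / a i) at_top at_top"
      using a[of i] by (simp add: filterlim_at_top_mult_tendsto_pos divide_inverse filterlim_ident
          filterlim_tendsto_pos_mult_at_top[OF tendsto_const] mult.commute[of _ "inverse (a i)"])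
    from filterlim_compose[OF Q0 this]
    have "((\<lambda>s. (s / a i) ^ r * (Q (s / a i) - 1)) \<longlongrightarrow> c / l * fact (r + 1)) at_top" .
    from tendsto_mult[OF this tendsto_const[of "a i ^ r"]] show ?thesis
      using a[of i] by (simp add: power_divide)
  qed
  \<comment> \<open>The factor of the order statistic is filed under the spare index \<open>0\<close>.\<close>
  have "((\<lambda>s. s ^ r * ((\<Prod>i\<in>{0..j}. if i = 0 then R m s else Q (s / a i)) - 1))
      \<longlongrightarrow> (\<Sum>i\<in>{0..j}. if i = 0 then c / l * (fact (m + r) / fact (m - 1)) else c / l * fact (r + 1) * a i ^ r)) at_top"
    by (rule prod_perturbation_tendsto[OF _ r]) (use Rlim[of m] Qlim m kn in auto)
  also have "(\<Sum>i\<in>{0..j}. if i = 0 then c / l * (fact (m + r) / fact (m - 1)) else c / l * fact (r + 1) * a i ^ r)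
      = c / l * (fact (m + r) / fact (m - 1) + fact (r + 1) * (\<Sum>i=1..j. a i ^ r))"
    by (simp add: sum.atLeast_Suc_atMost sum_distrib_left distrib_left mult.assoc)
  finally have "((\<lambda>s. s ^ r * (R k s - 1))
      \<longlongrightarrow> c / l * (fact (m + r) / fact (m - 1) + fact (r + 1) * (\<Sum>i=1..j. a i ^ r))) at_top"
  proof (rule Lim_transform_eventually)
    show "\<forall>\<^sub>F s in at_top. s ^ r * ((\<Prod>i\<in>{0..j}. if i = 0 then R m s else Q (s / a i)) - 1) = s ^ r * (R k s - 1)"
      using eventually_gt_at_top[of 0]
    proof eventually_elim
      case (elim s)
      have e: "laplace_stieltjes (exp_cdf l) (s / a i) = a i * l / (a i * l + s)" for i
        using a[of i] l elim by (simp add: laplace_stieltjes_exp_cdf field_simps)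
      have F_k: "laplace_stieltjes (\<lambda>u. binomial_tail n k (F u)) s
          = laplace_stieltjes (\<lambda>u. binomial_tail n m (F u)) s * (\<Prod>i=1..j. laplace_stieltjes F (s / a i))"
        using rel[OF elim] by (simp only: a_def k_def)
      have "m + j \<le> n" using kn by (simp add: k_def)
      from laplace_stieltjes_exp_order_stat[OF m this l elim]
      have E_k: "laplace_stieltjes (\<lambda>u. binomial_tail n k (exp_cdf l u)) s
          = laplace_stieltjes (\<lambda>u. binomial_tail n m (exp_cdf l u)) s * (\<Prod>i=1..j. laplace_stieltjes (exp_cdf l) (s / a i))"
        unfolding e by (simp only: a_def k_def)
      have "(\<Prod>i\<in>{0..j}. if i = 0 then R m s else Q (s / a i)) = R m s * (\<Prod>i=1..j. Q (s / a i))"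
        by (simp add: prod.atLeast_Suc_atMost)
      also have "\<dots> = R k s"
        by (simp add: R_def Q_def prod_dividef F_k E_k)
      finally show ?case by simp
    qed
  qed
  from tendsto_unique[OF _ this Rlim[of k]] kn
  have "c / l * (fact (m + r) / fact (m - 1) + fact (r + 1) * (\<Sum>i=1..j. a i ^ r))
      = c / l * (fact (k + r) / fact (k - 1))"
    by simp
  moreover have "c / l \<noteq> 0" using c l by simp
  ultimately have "fact (m + r) / fact (m - 1) + fact (r + 1) * (\<Sum>i=1..j. a i ^ r)
      = (fact (k + r) / fact (k - 1) :: real)"
    by (rule mult_left_cancel[THEN iffD1, rotated])
  moreover have "fact (k + r) / fact (k - 1)
      < fact (m + r) / fact (m - 1) + fact (r + 1) * (\<Sum>i=1..j. a i ^ r)"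
    using fact_quotient_less[OF m j r gap] by (simp only: k_def a_def of_nat_add)
  ultimately show False by simp
qed

section \<open>Power series of the distribution function\<close>

text \<open>Termwise integration of the series of \<open>f\<close>. A density is unrestricted on the negative half-line
  apart from carrying no mass there, so \<open>f\<close> is replaced by the sum \<open>g\<close> of its series, which is
  continuous on the whole line and equals \<open>f\<close> on \<open>[0, \<infinity>)\<close>.\<close>

lemma maclaurin_coefficients_of_cdf:
  assumes f: "is_pdf_of f F" "has_maclaurin_expansion f" and F0: "F 0 = 0"
  obtains p where "p 0 = 0" "p 1 = f 0" "\<And>x. summable (\<lambda>q. p q * x ^ q)"
    "\<And>x. x \<ge> 0 \<Longrightarrow> F x = (\<Sum>q. p q * x ^ q)"
proof -
  define c where "c q = half_line_deriv q f 0 / fact q" for q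
  have c0: "c 0 = f 0" by (simp add: c_def half_line_deriv_def)
  have sums: "(\<lambda>q. c q * x ^ q) sums f x" if "x \<ge> 0" for x
  proof (cases "x = 0")
    case True
    then show ?thesis using powser_sums_zero[of c] c0 by simp
  next
    case False
    then show ?thesis using f(2) that by (simp add: has_maclaurin_expansion_def c_def)
  qed
  have sc: "summable (\<lambda>q. norm (c q * x ^ q))" for x
    by (rule powser_insidea[OF sums_summable[OF sums[of "\<bar>x\<bar> + 1"]]]) auto
  define p where "p q = (if q = 0 then 0 else c (q - 1) / real q)" for q
  have sp: "summable (\<lambda>q. p q * x ^ q)" for x
  proof -
    have "summable (\<lambda>q. p (Suc q) * x ^ Suc q)"
    proof (rule summable_comparison_test')
      show "summable (\<lambda>q. \<bar>x\<bar> * norm (c q * x ^ q))" by (intro summable_mult sc)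
      \<comment> \<open>Integration only improves convergence: the coefficients gain a factor \<open>1 / (q + 1)\<close>.\<close>
      show "norm (p (Suc q) * x ^ Suc q) \<le> \<bar>x\<bar> * norm (c q * x ^ q)" if "q \<ge> 0" for q
      proof -
        have "norm (p (Suc q) * x ^ Suc q) = \<bar>x\<bar> * norm (c q * x ^ q) / real (Suc q)"
          by (simp add: p_def abs_mult)
        also have "\<dots> \<le> \<bar>x\<bar> * norm (c q * x ^ q) / 1"
          by (intro divide_left_mono) auto
        finally show ?thesis by simp
      qed
    qed
    then show ?thesis by (subst (asm) summable_Suc_iff)
  qed
  define P g where "P x = (\<Sum>q. p q * x ^ q)" and "g x = (\<Sum>q. c q * x ^ q)" for x :: real
  have "diffs p = c" by (auto simp: diffs_def p_def fun_eq_iff)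
  then have DP: "(P has_real_derivative g x) (at x)" for x
    using termdiffs_strong_converges_everywhere[of p x] sp unfolding P_def g_def by simp
  have P0: "P 0 = 0" by (simp add: P_def p_def)
  have gf: "g x = f x" if "x \<ge> 0" for x
    using sums_unique[OF sums[OF that]] by (simp add: g_def)
  have "(g has_real_derivative (\<Sum>q. diffs c q * x ^ q)) (at x)" for x
    unfolding g_def by (rule termdiffs_strong_converges_everywhere) (rule summable_norm_cancel[OF sc])
  then have "continuous_on UNIV g"
    by (meson DERIV_isCont continuous_at_imp_continuous_on)
  then have g_borel: "g \<in> borel_measurable borel"
    by (rule borel_measurable_continuous_onI)
  let ?N = "density lborel (\<lambda>x. ennreal (f x))"
  have [measurable]: "f \<in> borel_measurable borel" and f_nonneg: "\<And>x. 0 \<le> f x"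
    and N: "prob_space ?N" and Fc: "F = cdf ?N"
    using f(1) by (auto simp: is_pdf_of_def)
  interpret N: prob_space ?N by fact
  have FP: "F x = P x" if "x \<ge> 0" for x
  proof -
    have "N.prob {..x} = N.prob ({..0} \<union> {0<..x})"
      using that by (intro arg_cong[of _ _ N.prob]) auto
    also have "\<dots> = N.prob {..0} + N.prob {0<..x}"
      by (rule N.finite_measure_Union) auto
    finally have "F x = N.prob {0<..x}"
      using F0 by (simp add: Fc cdf_def)
    moreover have "emeasure ?N {0<..x} = ennreal (P x - P 0)"
    proof -
      have "emeasure ?N {0<..x} = (\<integral>\<^sup>+y. ennreal (f y) * indicator {0<..x} y \<partial>lborel)"
        by (rule emeasure_density) auto
      also have "\<dots> = (\<integral>\<^sup>+y. ennreal (g y) * indicator {0..x} y \<partial>lborel)"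
      proof (rule nn_integral_cong_AE)
        show "AE y in lborel. ennreal (f y) * indicator {0<..x} y = ennreal (g y) * indicator {0..x} y"
          using AE_lborel_singleton[of "0 :: real"]
          by eventually_elim (auto simp: indicator_def gf)
      qed
      also have "\<dots> = ennreal (P x - P 0)"
        using that by (intro nn_integral_FTC_Icc g_borel DP) (auto simp: gf f_nonneg)
      finally show ?thesis .
    qed
    moreover have "P 0 \<le> P x"
    proof (cases "x = 0")
      case False
      with that have "0 < x" by simp
      then obtain z where "0 < z" "P x - P 0 = (x - 0) * g z"
        using MVT2[of 0 x P g] DP by auto
      moreover have "0 \<le> x * f z" using that f_nonneg[of z] by simp
      ultimately show ?thesis by (simp add: gf)
    qed simp
    ultimately show ?thesis by (simp add: measure_def P0)
  qed
  show thesis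
    by (rule that[of p]) (use sp FP in \<open>auto simp: p_def c0 P_def\<close>)
qed

lemma exp_cdf_sums:
  "(\<lambda>q. ((if q = 0 then 1 else 0) - (- l) ^ q / fact q) * x ^ q) sums exp_cdf l x"
proof -
  have "(\<lambda>q. (if q = 0 then 1 else 0) - (- l * x) ^ q /\<^sub>R fact q) sums (1 - exp (- l * x))"
    using sums_single[of 0 "\<lambda>_. 1 :: real"] by (intro sums_diff exp_converges) (simp add: eq_commute)
  also have "(\<lambda>q. (if q = 0 then 1 else 0) - (- l * x) ^ q /\<^sub>R fact q)
      = (\<lambda>q. ((if q = 0 then 1 else 0) - (- l) ^ q / fact q) * x ^ q)"
    by (auto simp: fun_eq_iff left_diff_distrib power_mult_distrib[symmetric] divide_inverse)
  finally show ?thesis by (simp add: exp_cdf_def)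
qed

lemma powser_leading_term_tendsto:
  fixes d :: "nat \<Rightarrow> real"
  assumes d: "\<And>x. summable (\<lambda>q. d q * x ^ q)" and z: "\<And>i. i < q \<Longrightarrow> d i = 0"
  shows "((\<lambda>x. (\<Sum>i. d i * x ^ i) / x ^ q) \<longlongrightarrow> d q) (at_right 0)"
proof -
  define h where "h x = (\<Sum>i. d (i + q) * x ^ i)" for x
  have s: "(\<lambda>i. d (i + q) * x ^ i) sums ((\<Sum>i. d i * x ^ i) / x ^ q)" if "x \<noteq> 0" for x
  proof -
    have "(\<lambda>i. d (i + q) * x ^ (i + q)) sums ((\<Sum>i. d i * x ^ i) - (\<Sum>i<q. d i * x ^ i))"
      using d[of x] by (intro sums_split_initial_segment summable_sums)
    also have "(\<Sum>i<q. d i * x ^ i) = 0" using z by simp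
    finally have "(\<lambda>i. d (i + q) * x ^ (i + q) / x ^ q) sums (((\<Sum>i. d i * x ^ i) - 0) / x ^ q)"
      by (rule sums_divide)
    then show ?thesis using that by (simp add: power_add)
  qed
  have "((\<lambda>x. (\<Sum>i. d i * x ^ i) / x ^ q) \<longlongrightarrow> d (0 + q)) (at 0)"
    by (rule powser_limit_0_strong[of 1]) (use s in auto)
  then show ?thesis by (auto intro: tendsto_within_subset)
qed

lemma exponential_cdf_eq:
  assumes "l > 0"
  shows "exponential_cdf l x = (if x < 0 then 0 else exp_cdf l x)"
  unfolding exponential_cdf_def cdf_def measure_def emeasure_erlang_density[OF assms]
  using assms by (auto simp: erlang_CDF_def exp_cdf_def)

section \<open>The characterization\<close>

theorem theorem1:
  fixes M :: "'a measure"
    and X X0 :: "nat \<Rightarrow> 'a \<Rightarrow> real"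
    and F :: "real \<Rightarrow> real"
    and n j k :: nat
  assumes "prob_space M"
    and "F \<in> maclaurin_family"
    and "1 \<le> j" and "j < k"
    and "real k < (real n + real j) / 2" and "(real n + real j) / 2 < real n"
    and "prob_space.indep_vars M (\<lambda>_. borel) X {1..n}"
    and "\<And>i. i \<in> {1..n} \<Longrightarrow> cdf (distr M borel (X i)) = F"
    and "prob_space.indep_vars M (\<lambda>_. borel) X0 {1..j}"
    and "\<And>i. i \<in> {1..j} \<Longrightarrow> cdf (distr M borel (X0 i)) = F"
    and "prob_space.indep_var M
           (PiM {1..n} (\<lambda>_. borel)) (\<lambda>\<omega>. \<lambda>i\<in>{1..n}. X i \<omega>)
           (PiM {1..j} (\<lambda>_. borel)) (\<lambda>\<omega>. \<lambda>i\<in>{1..j}. X0 i \<omega>)"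
    and "eq_in_dist M
           (\<lambda>\<omega>. order_stat X (k - j) n \<omega>
              + (\<Sum>i=1..j. 1 / (real n - real k + real i) * X0 i \<omega>))
           (\<lambda>\<omega>. order_stat X k n \<omega>)"
  shows "\<exists>l>0. F = exponential_cdf l"
proof -
  interpret prob_space M by fact
  define m where "m = k - j"
  have m: "1 \<le> m" "k = m + j" using assms(4) by (auto simp: m_def)
  have "2 * real k < real n + real j" using assms(5) by simp
  then have n: "2 * m + j < n" "k \<le> n" using m(2) by linarith+
  obtain N f where N: "real_distribution N" "F = cdf N" and F0: "F 0 = 0"
    and f: "is_pdf_of f F" "f 0 > 0" "has_maclaurin_expansion f"
    using assms(2) by (auto simp: maclaurin_family_def is_cdf_def)
  interpret N: real_distribution N by fact
  have F01: "0 \<le> F x" "F x \<le> 1" for x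
    using N.cdf_nonneg N.cdf_bounded_prob by (auto simp: N(2))
  have "mono F" by (auto simp: N(2) mono_def N.cdf_nondecreasing)
  then have F_borel: "F \<in> borel_measurable borel" by (rule borel_measurable_mono)
  have rel: "laplace_stieltjes (\<lambda>u. binomial_tail n (m + j) (F u)) s
     = laplace_stieltjes (\<lambda>u. binomial_tail n m (F u)) s * (\<Prod>i=1..j. laplace_stieltjes F (s / real (n - (m + j) + i)))"
    if s: "s > 0" for s
  proof -
    have "real (n - k + i) = real n - real k + real i" for i using n by simp
    with assms(12) have "eq_in_dist M (\<lambda>\<omega>. order_stat X m n \<omega> + (\<Sum>i=1..j. 1 / real (n - k + i) * X0 i \<omega>)) (order_stat X k n)"
      by (simp only: m_def)
    from laplace_stieltjes_order_stat_identity[OF _ _ _ _ F0 assms(7,8,9,10,11) _ this s] m n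
    show ?thesis by simp
  qed
  define l where "l = f 0"
  have l: "l > 0" using f(2) by (simp add: l_def)
  obtain p where p: "p 0 = 0" "p 1 = l" "\<And>x. summable (\<lambda>q. p q * x ^ q)"
    "\<And>x. x \<ge> 0 \<Longrightarrow> F x = (\<Sum>q. p q * x ^ q)"
    using maclaurin_coefficients_of_cdf[OF f(1,3) F0] unfolding l_def by blast
  define d where "d q = p q - ((if q = 0 then 1 else 0) - (- l) ^ q / fact q)" for q
  have d_sums: "(\<lambda>q. d q * x ^ q) sums ((\<Sum>q. p q * x ^ q) - exp_cdf l x)" for x
    unfolding d_def left_diff_distrib[of "p _"] by (intro sums_diff summable_sums p(3) exp_cdf_sums)
  \<comment> \<open>Coefficient \<open>1\<close> vanishes because the rate \<open>l\<close> was chosen as \<open>f 0\<close>.\<close>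
  have d01: "d 0 = 0" "d 1 = 0" using p(1,2) by (auto simp: d_def)
  have "d q = 0" for q
  proof (induction q rule: less_induct)
    case (less q)
    show ?case
    proof (cases "q < 2")
      case True
      then have "q = 0 \<or> q = 1" by auto
      then show ?thesis using d01 by auto
    next
      case False
      then obtain r where q: "q = Suc r" and r: "r \<ge> 1" by (cases q) auto
      \<comment> \<open>All earlier coefficients vanish, so \<open>d q\<close> is the leading one and the perturbation argument applies.\<close>
      have "((\<lambda>x. (\<Sum>i. d i * x ^ i) / x ^ Suc r) \<longlongrightarrow> d q) (at_right 0)"
        unfolding q[symmetric] by (rule powser_leading_term_tendsto[OF sums_summable[OF d_sums] less])
      then have "((\<lambda>x. (F x - exp_cdf l x) / x ^ Suc r) \<longlongrightarrow> d q) (at_right 0)"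
      proof (rule Lim_transform_eventually)
        show "\<forall>\<^sub>F x in at_right 0. (\<Sum>i. d i * x ^ i) / x ^ Suc r = (F x - exp_cdf l x) / x ^ Suc r"
          using eventually_at_right_less[of "0 :: real"]
          by eventually_elim (simp add: p(4) sums_unique[OF d_sums, symmetric])
      qed
      from perturbation_vanishes[OF m(1) assms(3) n(1) l r F_borel F01 rel this] show ?thesis .
    qed
  qed
  then have "F x = exp_cdf l x" if "x \<ge> 0" for x
    using d_sums[of x] p(4)[OF that] sums_unique2[of "\<lambda>_. 0 :: real" 0] by fastforce
  moreover have "F x = 0" if "x < 0" for x
    using monoD[OF \<open>mono F\<close>, of x 0] F0 F01(1)[of x] that by simp
  ultimately have "F = exponential_cdf l"
    using l by (auto simp: fun_eq_iff exponential_cdf_eq)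
  with l show ?thesis by blast
qed

end
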